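(* Let $\theta$ be a $d$-dimensional, nontrivial, primitive, bijective rectangular substitution on a finite alphabet $\mathcal{A}$. Then the quotient group $\mathrm{Sym}(\mathsf{X}_\theta,\mathbb{Z}^d)/\mathrm{Aut}(\mathsf{X}_\theta,\mathbb{Z}^d)$ is isomorphic to a subgroup of the hyperoctahedral group $Q_d\cong(\mathbb{Z}/2\mathbb{Z})\wr S_d=(\mathbb{Z}/2\mathbb{Z})^d\rtimes S_d$ (the symmetry group of the $d$-dimensional cube). Thus, the extended symmetry group $\mathrm{Sym}(\mathsf{X}_\theta,\mathbb{Z}^d)$ is virtually $\mathbb{Z}^d$, i.e. has a finite-index subgroup isomorphic to $\mathbb{Z}^d$.
   Context: For a finite set $\mathcal{A}$ (alphabet), $\mathcal{A}^{\mathbb{Z}^d}$ carries the product topology of the discrete topology, and the shift action is $(\sigma_{\vec{g}}(x))_{\vec{h}}=x_{\vec{h}-\vec{g}}$. A subshift is a closed shift-invariant subset. $\mathrm{Aut}(X,\mathbb{Z}^d)$ is the group of homeomorphisms $f:X\to X$ commuting with all $\sigma_{\vec{g}}$. An extended symmetry of $X$ is a bijective continuous map $f:X\to X$ for which there is $A\in\mathrm{GL}_d(\mathbb{Z})$ with $f\circ\sigma_{\vec{p}}=\sigma_{A\vec{p}}\circ f$ for all $\vec{p}\in\mathbb{Z}^d$; the extended symmetries form a group $\mathrm{Sym}(X,\mathbb{Z}^d)$ under composition. When the shift action on $X$ is faithful, $A=\psi(f)$ is determined by $f$, and $\psi:\mathrm{Sym}(X,\mathbb{Z}^d)\to\mathrm{GL}_d(\mathbb{Z})$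 is a group morphism with kernel $\mathrm{Aut}(X,\mathbb{Z}^d)$. A rectangular substitution is a map $\theta:\mathcal{A}\to\mathcal{A}^S$ with $S=\prod_{i=1}^d\{0,\dots,s_i-1\}$ for a size vector $\vec{s}=(s_1,\dots,s_d)$, where $s_i>1$ for all $i$. Products of vectors are componentwise. $\theta$ extends to $\theta_\infty:\mathcal{A}^{\mathbb{Z}^d}\to\mathcal{A}^{\mathbb{Z}^d}$ by $\theta_\infty(x)_{\vec{m}\cdot\vec{s}+\vec{k}}=\theta(x_{\vec{m}})_{\vec{k}}$ for $\vec{m}\in\mathbb{Z}^d,\vec{k}\in S$. By the same rule one defines the iterates $\theta^n(a)$, $a\in\mathcal{A}$, patterns with support $\prod_{i}\{0,\dots,s_i^n-1\}$. $\theta$ is primitive if for some $n$, for every $a\in\mathcal{A}$, $\theta^n(a)$ contains every symbol of $\mathcal{A}$. $\theta$ is bijective if for each $\vec{k}\in S$ the map $a\mapsto\theta(a)_{\vec{k}}$ is a bijection of $\mathcal{A}$. Let $\Sigma$ be the (finite) set of all accumulation points of the sequences $(\theta_\infty^k(x))_{k\in\mathbb{N}}$, $x\in\mathcal{A}^{\mathbb{Z}^d}$. The substitutive subshift is $\mathsf{X}_\theta=\bigcup_{x\in\Sigma}\overline{\{\sigma_{\vec{k}}(x):\vec{k}\in\mathbb{Z}^d\}}$. The minimal substitutive subshift $\mathsf{X}_\theta^\circ\subseteq\mathsf{X}_\theta$ is the set of $x\in\mathcal{A}^{\mathbb{Z}^d}$ such that for every finite $U\subset\mathbb{Z}^d$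 the pattern $x|_U$ occurs, up to translation, as a subpattern of $\theta^k(a)$ for some $k\in\mathbb{N}$, $a\in\mathcal{A}$. "Nontrivial" means: $s_i>1$ for all $i$, and the shift action on $\mathsf{X}_\theta^\circ$ is faithful (i.e. $\sigma_{\vec{k}}=\mathrm{id}$ on $\mathsf{X}_\theta^\circ$ only for $\vec{k}=\vec{0}$). *)

theory Defs
  imports "HOL-Analysis.Analysis" "HOL-Algebra.Bij" "HOL-Algebra.Product_Groups"
begin

section \<open>The full shift\<close>

type_synonym ('a, 'd) config = "int ^ 'd \<Rightarrow> 'a"

definition full_shift :: "('a, 'd::finite) config topology" where
  "full_shift = product_topology (\<lambda>_. discrete_topology UNIV) UNIV"

definition shift :: "int ^ 'd \<Rightarrow> ('a, 'd::finite) config \<Rightarrow> ('a, 'd) config" where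
  "shift g x = (\<lambda>h. x (h - g))"

definition faithful_shift_action :: "('a, 'd::finite) config set \<Rightarrow> bool" where
  "faithful_shift_action X \<longleftrightarrow> (\<forall>k. (\<forall>x\<in>X. shift k x = x) \<longrightarrow> k = 0)"


section \<open>Automorphisms and extended symmetries\<close>

text \<open>Self-maps of \<open>X\<close> are represented, as in \<^const>\<open>BijGroup\<close>, by functions that are
  \<^const>\<open>undefined\<close> outside \<open>X\<close>.\<close>

definition Aut_set :: "('a, 'd::finite) config set \<Rightarrow> (('a, 'd) config \<Rightarrow> ('a, 'd) config) set" where
  "Aut_set X = {f \<in> Bij X.
     homeomorphic_map (subtopology full_shift X) (subtopology full_shift X) f \<and>
     (\<forall>p. \<forall>x\<in>X. f (shift p x) = shift p (f x))}"

text \<open>For integer matrices, \<^const>\<open>invertible\<close> asks for an integer inverse, so it describes the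
  elements of the general linear group over the integers.\<close>

definition Sym_set :: "('a, 'd::finite) config set \<Rightarrow> (('a, 'd) config \<Rightarrow> ('a, 'd) config) set" where
  "Sym_set X = {f \<in> Bij X.
     continuous_map (subtopology full_shift X) (subtopology full_shift X) f \<and>
     (\<exists>A :: int ^ 'd ^ 'd. invertible A \<and>
        (\<forall>p. \<forall>x\<in>X. f (shift p x) = shift (A *v p) (f x)))}"

definition Sym_group :: "('a, 'd::finite) config set \<Rightarrow> (('a, 'd) config \<Rightarrow> ('a, 'd) config) monoid" where
  "Sym_group X = (BijGroup X)\<lparr>carrier := Sym_set X\<rparr>"


section \<open>Rectangular substitutions\<close>

text \<open>A substitution with size vector \<open>s\<close> is a function \<open>\<theta>\<close> where \<open>\<theta> a k\<close> is the symbol at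
  position \<open>k\<close> of the pattern of \<open>a\<close>. When all \<open>s $ i\<close> are positive, the definitions
  below look at positions \<open>k \<in> box s 1\<close> only.\<close>

definition box :: "int ^ 'd::finite \<Rightarrow> nat \<Rightarrow> (int ^ 'd) set" where
  "box s n = {k. \<forall>i. 0 \<le> k $ i \<and> k $ i < (s $ i) ^ n}"

text \<open>When all \<open>s $ i\<close> are positive, every position is uniquely of the form \<open>m * s + k\<close> (componentwise product) with
  \<open>k \<in> box s 1\<close>, namely with \<open>m = vdiv n s\<close> and \<open>k = vmod n s\<close>.\<close>

definition vdiv :: "int ^ 'd::finite \<Rightarrow> int ^ 'd \<Rightarrow> int ^ 'd" where
  "vdiv n s = (\<chi> i. n $ i div s $ i)"

definition vmod :: "int ^ 'd::finite \<Rightarrow> int ^ 'd \<Rightarrow> int ^ 'd" where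
  "vmod n s = (\<chi> i. n $ i mod s $ i)"

definition subst_inf ::
  "int ^ 'd::finite \<Rightarrow> ('a \<Rightarrow> int ^ 'd \<Rightarrow> 'a) \<Rightarrow> ('a, 'd) config \<Rightarrow> ('a, 'd) config" where
  "subst_inf s \<theta> x = (\<lambda>n. \<theta> (x (vdiv n s)) (vmod n s))"

lemma subst_inf_eq:
  assumes "k \<in> box s 1"
  shows "subst_inf s \<theta> x (m * s + k) = \<theta> (x m) k"
proof -
  have k: "0 \<le> k $ i" "k $ i < s $ i" for i
    using assms by (auto simp: box_def)
  have "(m $ i * s $ i + k $ i) div s $ i = m $ i" for i
    using k[of i] by simp
  moreover have "(m $ i * s $ i + k $ i) mod s $ i = k $ i" for i
    using k[of i] by simp
  ultimately have "vdiv (m * s + k) s = m" "vmod (m * s + k) s = k"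
    by (simp_all add: vdiv_def vmod_def vec_eq_iff)
  then show ?thesis
    by (simp add: subst_inf_def)
qed

text \<open>The pattern \<open>\<theta>\<^sup>n(a)\<close> is the restriction of \<open>subst_iter s \<theta> n a\<close> to \<open>box s n\<close>.\<close>

fun subst_iter ::
  "int ^ 'd::finite \<Rightarrow> ('a \<Rightarrow> int ^ 'd \<Rightarrow> 'a) \<Rightarrow> nat \<Rightarrow> 'a \<Rightarrow> int ^ 'd \<Rightarrow> 'a" where
  "subst_iter s \<theta> 0 a k = a"
| "subst_iter s \<theta> (Suc n) a k = \<theta> (subst_iter s \<theta> n a (vdiv k s)) (vmod k s)"

definition primitive_subst :: "int ^ 'd::finite \<Rightarrow> ('a \<Rightarrow> int ^ 'd \<Rightarrow> 'a) \<Rightarrow> bool" where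
  "primitive_subst s \<theta> \<longleftrightarrow> (\<exists>n. \<forall>a b. \<exists>k\<in>box s n. subst_iter s \<theta> n a k = b)"

definition bijective_subst :: "int ^ 'd::finite \<Rightarrow> ('a \<Rightarrow> int ^ 'd \<Rightarrow> 'a) \<Rightarrow> bool" where
  "bijective_subst s \<theta> \<longleftrightarrow> (\<forall>k\<in>box s 1. bij (\<lambda>a. \<theta> a k))"

text \<open>Accumulation points of a sequence are understood as its cluster points: every neighbourhood
  contains the terms of infinitely many indices.\<close>

definition subst_limit_points ::
  "int ^ 'd::finite \<Rightarrow> ('a \<Rightarrow> int ^ 'd \<Rightarrow> 'a) \<Rightarrow> ('a, 'd) config set" where
  "subst_limit_points s \<theta> = {y. \<exists>x. \<forall>U. openin full_shift U \<and> y \<in> U \<longrightarrow>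
     (\<exists>\<^sub>F k in sequentially. (subst_inf s \<theta> ^^ k) x \<in> U)}"

definition subst_shift ::
  "int ^ 'd::finite \<Rightarrow> ('a \<Rightarrow> int ^ 'd \<Rightarrow> 'a) \<Rightarrow> ('a, 'd) config set" where
  "subst_shift s \<theta> =
     (\<Union>x\<in>subst_limit_points s \<theta>. full_shift closure_of (range (\<lambda>k. shift k x)))"

definition min_subst_shift ::
  "int ^ 'd::finite \<Rightarrow> ('a \<Rightarrow> int ^ 'd \<Rightarrow> 'a) \<Rightarrow> ('a, 'd) config set" where
  "min_subst_shift s \<theta> = {x. \<forall>U. finite U \<longrightarrow>
     (\<exists>n a t. \<forall>u\<in>U. u + t \<in> box s n \<and> x u = subst_iter s \<theta> n a (u + t))}"

definition nontrivial_subst :: "int ^ 'd::finite \<Rightarrow> ('a \<Rightarrow> int ^ 'd \<Rightarrow> 'a) \<Rightarrow> bool" where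
  "nontrivial_subst s \<theta> \<longleftrightarrow>
     (\<forall>i. s $ i > 1) \<and> faithful_shift_action (min_subst_shift s \<theta>)"


section \<open>The hyperoctahedral group\<close>

definition semidirect_product ::
  "('n, 'x) monoid_scheme \<Rightarrow> ('h, 'y) monoid_scheme \<Rightarrow> ('h \<Rightarrow> 'n \<Rightarrow> 'n) \<Rightarrow> ('n \<times> 'h) monoid" where
  "semidirect_product N H \<phi> =
     \<lparr>carrier = carrier N \<times> carrier H,
      monoid.mult = (\<lambda>(a, g) (b, h). (a \<otimes>\<^bsub>N\<^esub> \<phi> g b, g \<otimes>\<^bsub>H\<^esub> h)),
      one = (\<one>\<^bsub>N\<^esub>, \<one>\<^bsub>H\<^esub>)\<rparr>"

text \<open>Permutations act on \<open>(\<int>/2\<int>)\<^sup>d\<close> by permuting coordinates.\<close>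

definition hyperoctahedral_group :: "(('d::finite \<Rightarrow> int) \<times> ('d \<Rightarrow> 'd)) monoid" where
  "hyperoctahedral_group =
     semidirect_product (product_group UNIV (\<lambda>_. integer_mod_group 2)) (BijGroup UNIV)
       (\<lambda>\<pi> a. a \<circ> inv_into UNIV \<pi>)"

lemma group_hyperoctahedral_group: "group hyperoctahedral_group"
proof -
  let ?N = "product_group (UNIV :: 'd set) (\<lambda>_. integer_mod_group 2)"
  let ?H = "BijGroup (UNIV :: 'd set)"
  interpret N: group ?N by simp
  interpret H: group ?H by (rule group_BijGroup)
  have cH: "carrier ?H = {\<pi>. bij \<pi>}"
    by (auto simp: BijGroup_def Bij_def)
  have mH: "g \<otimes>\<^bsub>?H\<^esub> h = g \<circ> h" if "bij g" "bij h" for g h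
    using that by (auto simp: BijGroup_def Bij_def compose_def)
  have oH: "\<one>\<^bsub>?H\<^esub> = id"
    by (auto simp: BijGroup_def)
  have cN: "a \<circ> f \<in> carrier ?N" if "a \<in> carrier ?N" for a and f :: "'d \<Rightarrow> 'd"
    using that by auto
  have mN: "(a \<otimes>\<^bsub>?N\<^esub> b) \<circ> f = (a \<circ> f) \<otimes>\<^bsub>?N\<^esub> (b \<circ> f)" for a b and f :: "'d \<Rightarrow> 'd"
    by auto
  have oN: "\<one>\<^bsub>?N\<^esub> \<circ> f = \<one>\<^bsub>?N\<^esub>" for f :: "'d \<Rightarrow> 'd"
    by auto
  show ?thesis
    unfolding hyperoctahedral_group_def semidirect_product_def
  proof (rule groupI, goal_cases)
    case (1 x y)
    then show ?case
      using cN N.m_closed H.m_closed by (auto split: prod.splits simp del: carrier_product_group mult_product_group)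
  next
    case 2
    then show ?case by (simp del: carrier_product_group one_product_group)
  next
    case (3 x y z)
    obtain a f b g c h where xyz: "x = (a, f)" "y = (b, g)" "z = (c, h)"
      by (metis surj_pair)
    have ab: "a \<in> carrier ?N" "b \<in> carrier ?N" "c \<in> carrier ?N" "bij f" "bij g" "bij h"
      using 3 cH by (auto simp: xyz simp del: carrier_product_group)
    have "inv_into UNIV (f \<circ> g) = inv_into UNIV g \<circ> inv_into UNIV f"
      using ab by (simp add: o_inv_distrib)
    then show ?case
      using ab N.m_assoc[OF ab(1) cN[OF ab(2)] cN[OF ab(3)]]
      by (simp add: xyz mH mN bij_comp comp_assoc del: carrier_product_group mult_product_group)
  next
    case (4 x)
    then show ?case
      using cN by (auto simp: oH mH cH simp del: carrier_product_group mult_product_group one_product_group)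
  next
    case (5 x)
    obtain a f where x: "x = (a, f)" by (metis surj_pair)
    have a: "a \<in> carrier ?N" and f: "bij f"
      using 5 cH by (auto simp: x simp del: carrier_product_group)
    let ?g = "inv_into UNIV f"
    have g: "bij ?g" using f by (rule bij_imp_bij_inv)
    have gf: "inv_into UNIV ?g = f" using f by (rule inv_inv_eq)
    let ?b = "inv\<^bsub>?N\<^esub> (a \<circ> f)"
    have "?b \<in> carrier ?N" "?b \<otimes>\<^bsub>?N\<^esub> (a \<circ> f) = \<one>\<^bsub>?N\<^esub>"
      using cN[OF a] by (blast intro: N.inv_closed N.l_inv)+
    moreover have "?g \<otimes>\<^bsub>?H\<^esub> f = \<one>\<^bsub>?H\<^esub>"
      using f g by (simp add: mH oH bij_is_inj)
    ultimately show ?case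
      using g by (intro bexI[of _ "(?b, ?g)"])
        (auto simp: x cH gf simp del: carrier_product_group mult_product_group one_product_group)
  qed
qed

end

theory Submission
  imports Defs
begin

text \<open>
  Two points of \<open>X = subst_shift s \<theta>\<close> that share a level-\<open>n\<close> grid and agree at one position of a
  supertile agree on the whole supertile, since \<open>\<theta>\<close> is bijective. Two points with different grids
  cannot agree on arbitrarily large cubes: the letters of neighbouring supertiles would be related
  by a fixed permutation, so one of the points would be locally periodic, and by primitivity the
  minimal subshift would be periodic. This replaces the general recognizability theorem.

  Because \<open>X\<close> contains the limit points of all seeds, there are limit points \<open>y, y'\<close> that agree
  exactly on a coordinate half-space. An extended symmetry \<open>f\<close> with matrix \<open>A\<close> sends them to points
  that agree on a half-space, whose normal vector is a row of the inverse \<open>B\<close> of \<open>A\<close>, and differ in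
  every large enough cube centred on the other side. The hyperplane must not cut a supertile into a
  large agreeing and a large differing part. For large \<open>n\<close> this forces the normal vector to be a
  multiple of a coordinate vector, so \<open>A\<close> is a signed permutation matrix, and it bounds the
  offset of the level-\<open>n\<close> grid of \<open>f y\<close> independently of \<open>n\<close>. Hence some translate of \<open>f\<close> maps the
  finite set of limit points to itself, and only finitely many \<open>f\<close> do so.
\<close>

section \<open>Finiteness and periodicity preliminaries\<close>

lemma finite_vec_box:
  fixes A :: "'d::finite \<Rightarrow> 'b set"
  assumes "\<And>i. finite (A i)"
  shows "finite {v :: 'b ^ 'd. \<forall>i. v $ i \<in> A i}"
proof -
  have "{v :: 'b ^ 'd. \<forall>i. v $ i \<in> A i} \<subseteq> vec_lambda ` (PiE UNIV A)"
  proof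
    fix v :: "'b ^ 'd" assume "v \<in> {v. \<forall>i. v $ i \<in> A i}"
    then have "vec_nth v \<in> PiE UNIV A" by auto
    then show "v \<in> vec_lambda ` (PiE UNIV A)"
      by (rule rev_image_eqI) (rule vec_nth_inverse[symmetric])
  qed
  moreover have "finite (PiE UNIV A)" using assms by (intro finite_PiE) auto
  ultimately show ?thesis using finite_surj by blast
qed

text \<open>There are finitely many operators on self-maps of a finite type, so two exponents
  \<open>m < n\<close> give the same power of every \<open>f\<close> at once; for bijective
  \<open>f\<close> the factor \<open>f ^^ m\<close> cancels.\<close>

lemma funpow_common_period:
  obtains p where "p > 0" "\<And>f :: 'a::finite \<Rightarrow> 'a. bij f \<Longrightarrow> f ^^ p = id"
proof -
  have "\<not> inj (\<lambda>n (f :: 'a \<Rightarrow> 'a). f ^^ n)"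
    using finite_imageD[of "\<lambda>n (f :: 'a \<Rightarrow> 'a). f ^^ n" UNIV] infinite_UNIV_nat
    by (metis finite finite_subset subset_UNIV)
  then obtain m n where mn: "(\<lambda>f :: 'a \<Rightarrow> 'a. f ^^ m) = (\<lambda>f. f ^^ n)" "m < n"
    unfolding inj_on_def by (metis linorder_neqE_nat)
  have "f ^^ (n - m) = id" if "bij f" for f :: "'a \<Rightarrow> 'a"
  proof
    fix a
    have b: "bij (f ^^ m)" using that by (rule bij_fn)
    then obtain c where c: "a = (f ^^ m) c" by (meson bij_pointE)
    have "(f ^^ (n - m)) a = (f ^^ n) c"
      using mn(2) by (simp add: c flip: funpow_add[THEN fun_cong, unfolded comp_def])
    also have "\<dots> = a" using fun_cong[OF mn(1), of f] c by simp
    finally show "(f ^^ (n - m)) a = id a" by simp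
  qed
  then show thesis using mn(2) that[of "n - m"] by simp
qed

definition psize :: "int ^ 'd::finite \<Rightarrow> nat \<Rightarrow> int ^ 'd" where
  "psize s n = (\<chi> i. (s $ i) ^ n)"

lemma psize_nth [simp]: "psize s n $ i = (s $ i) ^ n"
  by (simp add: psize_def)

text \<open>The centre may depend on the radius, so half-spaces qualify
  (\<open>thick_halfspace\<close>); grids of two points will be compared through agreement on such a
  set.\<close>

definition thick :: "(int ^ 'd::finite) set \<Rightarrow> bool" where
  "thick T \<longleftrightarrow> (\<forall>R::int. \<exists>c. \<forall>h. (\<forall>i. \<bar>h $ i - c $ i\<bar> \<le> R) \<longrightarrow> h \<in> T)"

text \<open>The corner of the cube \<open>{-1, 0}\<^sup>d\<close> in the orthant of \<open>h\<close>. These corners are the only positions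
  whose letters determine the limits of iterates, because \<open>vdiv h (psize s n) = orth h\<close> for large \<open>n\<close>.\<close>

definition orth :: "int ^ 'd::finite \<Rightarrow> int ^ 'd" where
  "orth h = (\<chi> i. if 0 \<le> h $ i then 0 else -1)"

section \<open>Supertiles and grids\<close>

lemma vdiv_vmod: "vdiv h q * q + vmod h q = h"
  by (simp add: vdiv_def vmod_def vec_eq_iff div_mult_mod_eq)

locale rect_subst =
  fixes s :: "int ^ 'd::finite"
    and \<theta> :: "'a::finite \<Rightarrow> int ^ 'd \<Rightarrow> 'a"
  assumes s_gt_1: "1 < s $ i"
begin

abbreviation "\<Theta> \<equiv> subst_iter s \<theta>"

text \<open>The point is tiled by level-\<open>n\<close> supertiles with one corner at
  \<open>k\<close>. Nothing is asked of the arrangement of the letters \<open>a\<close>, so this is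
  a condition on finite windows of one fixed shape. The offset \<open>k\<close> matters only modulo
  \<open>psize s n\<close> (\<open>has_grid_cong\<close>).\<close>

definition has_grid :: "nat \<Rightarrow> int ^ 'd \<Rightarrow> ('a, 'd) config \<Rightarrow> bool" where
  "has_grid n k x \<longleftrightarrow> (\<forall>m. \<exists>a. \<forall>j\<in>box s n. x (m * psize s n + j + k) = \<Theta> n a j)"

lemma size_pos: "0 < s $ i ^ n"
  using s_gt_1[of i] by simp

lemma size_gt: "int n < s $ i ^ n"
proof -
  have "int n < 2 ^ n" by simp
  also have "\<dots> \<le> s $ i ^ n" using s_gt_1[of i] by (intro power_mono) auto
  finally show ?thesis .
qed

lemma zero_in_box: "0 \<in> box s n"
  using size_pos by (simp add: box_def)

lemma box_zero: "j \<in> box s 0 \<longleftrightarrow> j = 0"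
proof -
  have "0 \<le> a \<and> a < 1 \<longleftrightarrow> a = 0" for a :: int by auto
  then show ?thesis by (simp add: box_def vec_eq_iff)
qed

lemma finite_box: "finite (box s n)"
proof -
  have "box s n = {k. \<forall>i. k $ i \<in> {0..<s $ i ^ n}}" by (auto simp: box_def)
  then show ?thesis using finite_vec_box[of "\<lambda>i. {0..<s $ i ^ n}"] by simp
qed

lemma vmod_in_box: "vmod h (psize s n) \<in> box s n"
  using size_pos by (simp add: box_def vmod_def)

lemma grid_position:
  obtains m j where "j \<in> box s n" "h = m * psize s n + j + k"
proof
  show "vmod (h - k) (psize s n) \<in> box s n" by (rule vmod_in_box)
  show "h = vdiv (h - k) (psize s n) * psize s n + vmod (h - k) (psize s n) + k"
    by (simp add: vdiv_vmod)
qed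

lemma psize_Suc: "psize s (Suc n) = psize s n * s"
  by (simp add: vec_eq_iff)

lemma vdiv_in_box:
  assumes "j \<in> box s (Suc n)"
  shows "vdiv j s \<in> box s n"
proof -
  have "0 \<le> j $ i div s $ i \<and> j $ i div s $ i < s $ i ^ n" for i
  proof -
    have "0 \<le> j $ i" "j $ i < s $ i ^ n * s $ i" "0 < s $ i"
      using assms s_gt_1[of i] by (auto simp: box_def mult.commute)
    moreover from this have "j $ i div s $ i * s $ i < s $ i ^ n * s $ i"
      using div_mult_mod_eq[of "j $ i" "s $ i"] pos_mod_sign[of "s $ i" "j $ i"] by linarith
    ultimately show ?thesis
      by (simp add: pos_imp_zdiv_nonneg_iff)
  qed
  then show ?thesis by (simp add: box_def vdiv_def)
qed

lemma vmod_in_box1: "vmod j s \<in> box s 1"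
  using s_gt_1 by (simp add: box_def vmod_def order_less_trans[OF zero_less_one])

lemma box_combine:
  assumes "q \<in> box s r" "j \<in> box s n"
  shows "q * psize s n + j \<in> box s (r + n)"
proof -
  have "0 \<le> q $ i * s $ i ^ n + j $ i \<and> q $ i * s $ i ^ n + j $ i < s $ i ^ (r + n)" for i
  proof -
    have q: "0 \<le> q $ i" "q $ i + 1 \<le> s $ i ^ r" and j: "0 \<le> j $ i" "j $ i < s $ i ^ n"
      using assms by (simp_all add: box_def add1_zle_eq)
    have "(q $ i + 1) * s $ i ^ n \<le> s $ i ^ r * s $ i ^ n"
      using q size_pos[of i n] by (intro mult_right_mono) auto
    then show ?thesis using q j size_pos[of i n] by (simp add: power_add algebra_simps)
  qed
  then show ?thesis by (simp add: box_def)
qed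

lemma vdiv_step: "vdiv (m * psize s (Suc n) + j) s = m * psize s n + vdiv j s"
proof -
  have "(m $ i * (s $ i * s $ i ^ n) + j $ i) div s $ i = m $ i * s $ i ^ n + j $ i div s $ i" for i
    using s_gt_1[of i] div_mult_self2[of "s $ i" "j $ i" "m $ i * s $ i ^ n"]
    by (simp add: algebra_simps)
  then show ?thesis by (simp add: vdiv_def vec_eq_iff)
qed

lemma vmod_step: "vmod (m * psize s (Suc n) + j) s = vmod j s"
proof -
  have "(m $ i * (s $ i * s $ i ^ n) + j $ i) mod s $ i = j $ i mod s $ i" for i
    using mod_mult_self2[of "j $ i" "s $ i" "m $ i * s $ i ^ n"] by (simp add: algebra_simps)
  then show ?thesis by (simp add: vmod_def vec_eq_iff)
qed

text \<open>A supertile of level \<open>r + n\<close> consists of level-\<open>n\<close> supertiles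
  whose letters form the level-\<open>r\<close> supertile. Only \<open>j\<close> is confined to a
  box: the identity concerns the total functions, so \<open>q\<close> may be any position.\<close>

lemma subst_iter_add:
  "j \<in> box s n \<Longrightarrow> \<Theta> (r + n) a (q * psize s n + j) = \<Theta> n (\<Theta> r a q) j"
proof (induction n arbitrary: j)
  case 0
  then have "j = 0" by (simp add: box_zero)
  moreover have "psize s 0 = 1" by (simp add: vec_eq_iff)
  ultimately show ?case by simp
next
  case (Suc n)
  then show ?case by (simp add: vdiv_step vmod_step vdiv_in_box)
qed

lemma subst_inf_funpow:
  "j \<in> box s n \<Longrightarrow> (subst_inf s \<theta> ^^ n) x (m * psize s n + j) = \<Theta> n (x m) j"
proof (induction n arbitrary: j)
  case 0
  then have "j = 0" by (simp add: box_zero)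
  moreover have "psize s 0 = 1" by (simp add: vec_eq_iff)
  ultimately show ?case by simp
next
  case (Suc n)
  have "(subst_inf s \<theta> ^^ Suc n) x (m * psize s (Suc n) + j) =
     \<theta> ((subst_inf s \<theta> ^^ n) x (m * psize s n + vdiv j s)) (vmod j s)"
    by (simp add: subst_inf_def vdiv_step vmod_step)
  then show ?case using Suc by (simp add: vdiv_in_box)
qed

lemma has_grid_subst_inf:
  assumes "n \<le> N"
  shows "has_grid n 0 ((subst_inf s \<theta> ^^ N) x)"
proof -
  obtain r where "N = n + r" using assms le_Suc_ex by blast
  then have "(subst_inf s \<theta> ^^ N) x = (subst_inf s \<theta> ^^ n) ((subst_inf s \<theta> ^^ r) x)"
    by (simp add: funpow_add)
  then show ?thesis
    unfolding has_grid_def by (auto simp: subst_inf_funpow)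
qed

text \<open>Supertiles subdivide into those of the next lower level: the one with index
  \<open>m\<close> has parent index \<open>vdiv m s\<close> and sits at place
  \<open>vmod m s\<close> in it.\<close>

lemma has_grid_Suc:
  assumes "has_grid (Suc n) k x"
  shows "has_grid n k x"
  unfolding has_grid_def
proof
  fix m
  obtain a where a: "\<And>j. j \<in> box s (Suc n) \<Longrightarrow>
      x (vdiv m s * psize s (Suc n) + j + k) = \<Theta> (Suc n) a j"
    using assms unfolding has_grid_def by meson
  have "x (m * psize s n + j + k) = \<Theta> n (\<Theta> 1 a (vmod m s)) j" if j: "j \<in> box s n" for j
  proof -
    have eq: "vdiv m s * psize s (Suc n) + (vmod m s * psize s n + j) = m * psize s n + j"
      using arg_cong[OF vdiv_vmod[of m s], of "\<lambda>v. v * psize s n"]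
      by (simp add: psize_Suc algebra_simps)
    have "vmod m s * psize s n + j \<in> box s (1 + n)"
      by (intro box_combine vmod_in_box1 j)
    from a[OF this[simplified]] show ?thesis
      using subst_iter_add[OF j, of 1 a "vmod m s"] by (simp only: eq) simp
  qed
  then show "\<exists>a. \<forall>j\<in>box s n. x (m * psize s n + j + k) = \<Theta> n a j" by blast
qed

lemma has_grid_le:
  assumes "has_grid N k x" "n \<le> N"
  shows "has_grid n k x"
  using assms(2,1) by (induction rule: inc_induct) (auto intro: has_grid_Suc)

lemma has_grid_shift: "has_grid n k (shift g x) \<longleftrightarrow> has_grid n (k - g) x"
  by (simp add: has_grid_def shift_def algebra_simps)

lemma has_grid_cong:
  assumes "has_grid n k x" "\<And>i. s $ i ^ n dvd k' $ i - k $ i"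
  shows "has_grid n k' x"
  unfolding has_grid_def
proof
  fix m
  define q where "q = vdiv (k' - k) (psize s n)"
  have "vdiv (k' - k) (psize s n) * psize s n = k' - k"
    using assms(2) by (simp add: vdiv_def vec_eq_iff)
  then have eq: "m * psize s n + j + k' = (m + q) * psize s n + j + k" for j
    by (simp add: q_def algebra_simps)
  show "\<exists>a. \<forall>j\<in>box s n. x (m * psize s n + j + k') = \<Theta> n a j"
    unfolding eq using assms(1) unfolding has_grid_def by blast
qed

text \<open>For fixed \<open>k\<close> the condition at each index \<open>m\<close> concerns one
  finite translate of \<open>box s n\<close>, so local approximations suffice.\<close>

lemma has_grid_local_limit:
  assumes "\<And>U. finite U \<Longrightarrow> \<exists>w. has_grid n k w \<and> (\<forall>h\<in>U. x h = w h)"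
  shows "has_grid n k x"
  unfolding has_grid_def
proof
  fix m
  obtain w where w: "has_grid n k w" "\<And>h. h \<in> (\<lambda>j. m * psize s n + j + k) ` box s n \<Longrightarrow> x h = w h"
    using assms[of "(\<lambda>j. m * psize s n + j + k) ` box s n"] finite_box by blast
  then show "\<exists>a. \<forall>j\<in>box s n. x (m * psize s n + j + k) = \<Theta> n a j"
    unfolding has_grid_def by simp
qed

text \<open>Offsets reduce to the finite set \<open>box s n\<close>. If each of them failed for
  \<open>x\<close>, each failure would show in a finite window; but a translate of \<open>y\<close>
  matching \<open>x\<close> on the union of these windows has one of these offsets.\<close>

lemma has_grid_orbit_closure:
  assumes "has_grid n 0 y" and x: "\<And>U. finite U \<Longrightarrow> \<exists>g. \<forall>h\<in>U. x h = shift g y h"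
  shows "\<exists>k. has_grid n k x"
proof (rule ccontr)
  assume "\<nexists>k. has_grid n k x"
  then have "\<exists>U. finite U \<and> (\<forall>w. has_grid n k w \<longrightarrow> (\<exists>h\<in>U. x h \<noteq> w h))" for k
    using has_grid_local_limit[of n k x] by metis
  then obtain U where U: "\<And>k. finite (U k)" "\<And>k w. has_grid n k w \<Longrightarrow> \<exists>h\<in>U k. x h \<noteq> w h"
    by metis
  obtain g where g: "\<And>h. h \<in> (\<Union>k\<in>box s n. U k) \<Longrightarrow> x h = shift g y h"
    using x[of "\<Union>k\<in>box s n. U k"] finite_box U(1) by blast
  have "has_grid n g (shift g y)" using assms(1) by (simp add: has_grid_shift)
  then have "has_grid n (vmod g (psize s n)) (shift g y)"
    by (rule has_grid_cong) (auto simp: vmod_def mod_eq_dvd_iff[symmetric])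
  then show False using U(2) g vmod_in_box[of g n] by blast
qed

text \<open>For \<open>w\<close> in the minimal subshift, the letters at \<open>h\<close> and
  \<open>h - P\<close> occur together in some iterate of a letter, hence by primitivity in every
  supertile of level \<open>n0 + n\<close>. One of these fits in a cube on which \<open>x\<close>
  has period \<open>P\<close>, so \<open>w\<close> has period \<open>P\<close> everywhere, against
  faithfulness.\<close>

lemma no_local_period:
  assumes prim: "primitive_subst s \<theta>" and faith: "faithful_shift_action (min_subst_shift s \<theta>)"
    and grid: "\<And>n. \<exists>k. has_grid n k x" and P: "P \<noteq> 0"
  shows "\<not> thick {h. x (h + P) = x h}"
proof
  assume T: "thick {h. x (h + P) = x h}"
  have "shift P w h = w h" if w: "w \<in> min_subst_shift s \<theta>" for w h
  proof -
    obtain n a t where nat: "\<And>u. u \<in> {h, h - P} \<Longrightarrow> u + t \<in> box s n \<and> w u = \<Theta> n a (u + t)"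
    proof -
      have "\<exists>n a t. \<forall>u\<in>{h, h - P}. u + t \<in> box s n \<and> w u = \<Theta> n a (u + t)"
        using w unfolding min_subst_shift_def mem_Collect_eq
        by (drule_tac x = "{h, h - P}" in spec) simp
      then show thesis using that by meson
    qed
    obtain n0 where n0: "\<And>a b. \<exists>k\<in>box s n0. \<Theta> n0 a k = b"
      using prim unfolding primitive_subst_def by blast
    define N where "N = n0 + n"
    obtain k where k: "has_grid N k x" using grid by blast
    \<comment> \<open>The radius bounds every side of a level-\<open>N\<close> supertile, so the
      cube contains the supertile through its centre.\<close>
    obtain c where c: "\<And>h. (\<And>i. \<bar>h $ i - c $ i\<bar> \<le> (\<Sum>i\<in>UNIV. s $ i ^ N)) \<Longrightarrow> x (h + P) = x h"
      using T unfolding thick_def by blast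
    obtain m j where j: "j \<in> box s N" "c = m * psize s N + j + k" using grid_position by blast
    obtain a0 where a0: "\<And>j. j \<in> box s N \<Longrightarrow> x (m * psize s N + j + k) = \<Theta> N a0 j"
      using k unfolding has_grid_def by meson
    obtain e where e: "e \<in> box s n0" "\<Theta> n0 a0 e = a" using n0 by blast
    \<comment> \<open>\<open>H\<close> carries the window of \<open>w\<close> into \<open>x\<close>:
      to the supertile with letter \<open>a0\<close>, in it to the level-\<open>n\<close> supertile
      with letter \<open>a\<close> at place \<open>e\<close>, and there to the occurrence displaced
      by \<open>t\<close>.\<close>
    define H where "H = (\<lambda>u. m * psize s N + (e * psize s n + (u + t)) + k)"
    have H: "e * psize s n + (u + t) \<in> box s N" "x (H u) = w u" if "u \<in> {h, h - P}" for u
    proof -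
      have u: "u + t \<in> box s n" "w u = \<Theta> n a (u + t)" using nat that by auto
      show b: "e * psize s n + (u + t) \<in> box s N"
        unfolding N_def using box_combine e(1) u(1) by blast
      show "x (H u) = w u"
        unfolding H_def a0[OF b] using u e subst_iter_add[OF u(1)] by (simp add: N_def)
    qed
    have "\<bar>H (h - P) $ i - c $ i\<bar> \<le> (\<Sum>i\<in>UNIV. s $ i ^ N)" for i
    proof -
      have "\<bar>H (h - P) $ i - c $ i\<bar> \<le> s $ i ^ N"
        using H(1)[of "h - P"] j(1) unfolding box_def j(2) H_def by (auto dest!: spec[of _ i])
      also have "\<dots> \<le> (\<Sum>i\<in>UNIV. s $ i ^ N)"
        using size_pos by (intro member_le_sum) (auto intro: less_imp_le)
      finally show ?thesis .
    qed
    then have "x (H (h - P) + P) = x (H (h - P))" by (rule c)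
    moreover have "H (h - P) + P = H h" by (simp add: H_def algebra_simps)
    ultimately show ?thesis using H(2) by (simp add: shift_def)
  qed
  then have "\<forall>w\<in>min_subst_shift s \<theta>. shift P w = w" by blast
  then show False using faith P unfolding faithful_shift_action_def by blast
qed

end

lemma orth_nth [simp]: "orth h $ i = (if 0 \<le> h $ i then 0 else -1)"
  by (simp add: orth_def)

section \<open>Bijective substitutions and synchronisation of grids\<close>

locale bij_rect_subst = rect_subst s \<theta>
  for s :: "int ^ 'd::finite" and \<theta> :: "'a::finite \<Rightarrow> int ^ 'd \<Rightarrow> 'a" +
  assumes bij_letter: "k \<in> box s 1 \<Longrightarrow> bij (\<lambda>a. \<theta> a k)"
begin

lemma bij_iter: "j \<in> box s n \<Longrightarrow> bij (\<lambda>a. \<Theta> n a j)"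
proof (induction n arbitrary: j)
  case 0
  then show ?case by (simp flip: id_def)
next
  case (Suc n)
  have "bij ((\<lambda>a. \<theta> a (vmod j s)) \<circ> (\<lambda>a. \<Theta> n a (vdiv j s)))"
    using Suc by (intro bij_comp bij_letter vmod_in_box1) (auto intro: vdiv_in_box)
  then show ?case by (simp add: comp_def)
qed

lemma iter_eq_iff: "j \<in> box s n \<Longrightarrow> \<Theta> n a j = \<Theta> n b j \<longleftrightarrow> a = b"
  using bij_iter[of j n] by (auto dest: bij_is_inj injD)

lemma has_grid_letters:
  assumes "has_grid n k x"
  obtains z where "\<And>m j. j \<in> box s n \<Longrightarrow> x (m * psize s n + j + k) = \<Theta> n (z m) j"
  using assms unfolding has_grid_def by metis

text \<open>A single position of a supertile determines its letter, because each column map of the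
  iterated substitution is injective.\<close>

lemma box_agree:
  assumes "has_grid n k x" "has_grid n k x'" "j \<in> box s n" "j' \<in> box s n"
    and "x (m * psize s n + j + k) = x' (m * psize s n + j + k)"
  shows "x (m * psize s n + j' + k) = x' (m * psize s n + j' + k)"
proof -
  obtain z where z: "\<And>m j. j \<in> box s n \<Longrightarrow> x (m * psize s n + j + k) = \<Theta> n (z m) j"
    using has_grid_letters[OF assms(1)] by blast
  obtain z' where z': "\<And>m j. j \<in> box s n \<Longrightarrow> x' (m * psize s n + j + k) = \<Theta> n (z' m) j"
    using has_grid_letters[OF assms(2)] by blast
  show ?thesis using assms z z' by (simp add: iter_eq_iff)
qed

text \<open>If the grids were misaligned along \<open>i\<close>, walking from supertile to supertile
  in that direction would apply one fixed permutation to the letters of \<open>x\<close>. Its order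
  is finite, so \<open>x\<close> would have a period on a thick set, against
  \<open>no_local_period\<close>.\<close>

theorem grid_unique:
  assumes prim: "primitive_subst s \<theta>" and faith: "faithful_shift_action (min_subst_shift s \<theta>)"
    and grids: "\<And>n. \<exists>k. has_grid n k x"
    and T: "thick {h. x h = x' h}"
    and k: "has_grid n k x" and k': "has_grid n k' x'"
  shows "s $ i ^ n dvd k $ i - k' $ i"
proof (rule ccontr)
  assume ndvd: "\<not> s $ i ^ n dvd k $ i - k' $ i"
  define p where "p = psize s n"
  \<comment> \<open>Changing \<open>k'\<close> by a multiple of \<open>p\<close> leaves a
    discrepancy \<open>\<delta>\<close> between the grids that lies inside one supertile.\<close>
  define q where "q = vdiv (k - k') p"
  define \<delta> where "\<delta> = vmod (k - k') p"
  define k2 where "k2 = k' + q * p"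
  have \<delta>: "\<delta> \<in> box s n" unfolding \<delta>_def p_def by (rule vmod_in_box)
  have k2: "has_grid n k2 x'"
    using k' by (rule has_grid_cong) (simp add: k2_def p_def)
  have kk2: "k = k2 + \<delta>"
    using vdiv_vmod[of "k - k'" p] by (simp add: k2_def q_def \<delta>_def algebra_simps)
  have \<delta>i: "0 < \<delta> $ i" "\<delta> $ i < s $ i ^ n"
  proof -
    have "\<delta> $ i \<noteq> 0" using ndvd by (simp add: \<delta>_def vmod_def p_def dvd_eq_mod_eq_0)
    then show "0 < \<delta> $ i" "\<delta> $ i < s $ i ^ n" using \<delta> by (auto simp: box_def order_le_less)
  qed
  \<comment> \<open>In the supertile of \<open>x\<close> at \<open>m\<close>, place \<open>0\<close>
    is place \<open>\<delta>\<close> of the supertile of \<open>x'\<close> at \<open>m\<close>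
    (\<open>pos0\<close>), while place \<open>j1\<close> is place \<open>\<delta>1\<close> of the
    next one along \<open>i\<close> (\<open>pos1\<close>). That \<open>j1\<close> lies in the box
    needs \<open>0 < \<delta> $ i\<close>.\<close>
  define j1 where "j1 = (\<chi> l. if l = i then s $ i ^ n - \<delta> $ i else 0)"
  define \<delta>1 where "\<delta>1 = (\<chi> l. if l = i then 0 else \<delta> $ l)"
  define e where "e = (\<chi> l. if l = i then 1 else (0::int))"
  have j1: "j1 \<in> box s n" using \<delta>i size_pos by (simp add: box_def j1_def)
  have \<delta>1: "\<delta>1 \<in> box s n" using \<delta> size_pos by (simp add: box_def \<delta>1_def)
  have pos0: "m * p + 0 + k = m * p + \<delta> + k2" for m
    by (simp add: kk2 algebra_simps)
  have pos1: "m * p + j1 + k = (m + e) * p + \<delta>1 + k2" for m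
    by (simp add: kk2 vec_eq_iff j1_def \<delta>1_def e_def p_def algebra_simps)
  obtain z where z: "\<And>m j. j \<in> box s n \<Longrightarrow> x (m * p + j + k) = \<Theta> n (z m) j"
    using has_grid_letters[OF k] unfolding p_def by blast
  obtain z' where z': "\<And>m j. j \<in> box s n \<Longrightarrow> x' (m * p + j + k2) = \<Theta> n (z' m) j"
    using has_grid_letters[OF k2] unfolding p_def by blast
  \<comment> \<open>The supertile of \<open>x'\<close> at \<open>m + e\<close> meets the supertiles of \<open>x\<close> at \<open>m\<close> and \<open>m + e\<close>, in the same relative
    positions for every \<open>m\<close>, so its letter transports that of the former to that of the latter.\<close>
  let ?f = "\<lambda>j a. \<Theta> n a j"
  define \<rho> where "\<rho> = inv_into UNIV (?f 0) \<circ> ?f \<delta> \<circ> inv_into UNIV (?f \<delta>1) \<circ> ?f j1"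
  have bij\<rho>: "bij \<rho>"
    unfolding \<rho>_def by (intro bij_comp bij_imp_bij_inv bij_iter zero_in_box \<delta> \<delta>1 j1)
  have step: "z (m + e) = \<rho> (z m)"
    if a: "x (m * p + j1 + k) = x' (m * p + j1 + k)"
      and b: "x ((m + e) * p + 0 + k) = x' ((m + e) * p + 0 + k)" for m
  proof -
    have 1: "?f j1 (z m) = ?f \<delta>1 (z' (m + e))"
      using a z[OF j1, of m] z'[OF \<delta>1, of "m + e"] by (simp only: pos1)
    have 2: "?f 0 (z (m + e)) = ?f \<delta> (z' (m + e))"
      using b z[OF zero_in_box, of "m + e"] z'[OF \<delta>, of "m + e"] by (simp only: pos0)
    have "inv_into UNIV (?f \<delta>1) (?f j1 (z m)) = z' (m + e)"
      unfolding 1 using bij_is_inj[OF bij_iter[OF \<delta>1]] by (rule inv_f_f)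
    then have "\<rho> (z m) = inv_into UNIV (?f 0) (?f 0 (z (m + e)))" unfolding \<rho>_def by (simp add: 2)
    also have "\<dots> = z (m + e)" using bij_is_inj[OF bij_iter[OF zero_in_box]] by (rule inv_f_f)
    finally show ?thesis by simp
  qed
  obtain N where N: "N > 0" "\<And>f :: 'a \<Rightarrow> 'a. bij f \<Longrightarrow> f ^^ N = id"
    using funpow_common_period by blast
  \<comment> \<open>\<open>N\<close> steps of one supertile along \<open>i\<close>, after which the
    power of \<rho> is the identity.\<close>
  define P where "P = (\<chi> l. if l = i then int N * s $ i ^ n else 0)"
  have P0: "P \<noteq> 0" using N(1) s_gt_1[of i] by (auto simp: P_def vec_eq_iff)
  have eP: "(m + of_nat N * e) * p = m * p + P" for m
    by (simp add: vec_eq_iff P_def e_def p_def algebra_simps of_nat_index)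
  define B where "B = (\<Sum>l\<in>UNIV. s $ l ^ n)"
  have B: "s $ l ^ n \<le> B" for l
    unfolding B_def using size_pos by (intro member_le_sum) (auto intro: less_imp_le)
  have "thick {h. x (h + P) = x h}"
    unfolding thick_def
  proof
    fix R :: int
    \<comment> \<open>The margin leaves room for the supertile of \<open>h\<close> and the
      \<open>N\<close> following ones along \<open>i\<close>, since \<open>B\<close> bounds every
      side.\<close>
    obtain c where c: "\<And>h. (\<And>l. \<bar>h $ l - c $ l\<bar> \<le> R + (int N + 2) * B) \<Longrightarrow> x h = x' h"
      using T unfolding thick_def by blast
    have "x (h + P) = x h" if h: "\<And>l. \<bar>h $ l - c $ l\<bar> \<le> R" for h
    proof -
      obtain m j where j: "j \<in> box s n" "h = m * p + j + k"
        using grid_position unfolding p_def by blast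
      have near: "x ((m + of_nat t * e) * p + j' + k) = x' ((m + of_nat t * e) * p + j' + k)"
        if "t \<le> N" "j' \<in> box s n" for t j'
      proof (rule c)
        fix l
        have 1: "\<bar>j' $ l - j $ l\<bar> \<le> s $ l ^ n"
          using j(1) that(2) by (auto simp: box_def abs_le_iff dest!: spec[of _ l])
        have 2: "\<bar>(of_nat t * e) $ l * p $ l\<bar> \<le> int N * s $ l ^ n"
          using that(1) size_pos[of l n] by (auto simp: e_def p_def of_nat_index abs_mult intro: mult_right_mono)
        have "((m + of_nat t * e) * p + j' + k) $ l - c $ l
            = (h $ l - c $ l) + (j' $ l - j $ l) + (of_nat t * e) $ l * p $ l"
          by (simp add: j(2) algebra_simps)
        then have "\<bar>((m + of_nat t * e) * p + j' + k) $ l - c $ l\<bar> \<le> R + s $ l ^ n + int N * s $ l ^ n"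
          using h[of l] 1 2 by linarith
        also have "\<dots> \<le> R + B + int N * B"
          using B[of l] by (intro add_mono mult_left_mono) auto
        also have "\<dots> \<le> R + (int N + 2) * B"
          using B[of l] size_pos[of l n] by (simp add: algebra_simps)
        finally show "\<bar>((m + of_nat t * e) * p + j' + k) $ l - c $ l\<bar> \<le> R + (int N + 2) * B" .
      qed
      have "z (m + of_nat t * e) = (\<rho> ^^ t) (z m)" if "t \<le> N" for t
        using that
      proof (induction t)
        case (Suc t)
        have "z (m + of_nat t * e + e) = \<rho> (z (m + of_nat t * e))"
          using near[of t j1] near[of "Suc t" 0] Suc.prems j1 zero_in_box
          by (intro step) (simp_all add: algebra_simps)
        then show ?case using Suc by (simp add: algebra_simps)
      qed simp
      then have "z (m + of_nat N * e) = z m" using N(2)[OF bij\<rho>] by simp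
      then show ?thesis
        using z[OF j(1), of m] z[OF j(1), of "m + of_nat N * e"] unfolding eP
        by (simp add: j(2) algebra_simps)
    qed
    then show "\<exists>c. \<forall>h. (\<forall>i. \<bar>h $ i - c $ i\<bar> \<le> R) \<longrightarrow> h \<in> {h. x (h + P) = x h}" by blast
  qed
  then show False using no_local_period[OF prim faith grids P0] by blast
qed

text \<open>By \<open>fixpts_periodic\<close> below, these are points fixed by a common power of the substitution.\<close>

definition fixpts :: "('a, 'd) config set" where
  "fixpts = {y. \<forall>n. has_grid n 0 y}"

text \<open>Since \<open>s $ i ^ n\<close> exceeds \<open>n\<close>, both \<open>h\<close> and
  \<open>orth h\<close> lie in the level-\<open>n\<close> supertile with index
  \<open>orth h\<close>, and \<open>box_agree\<close> applies.\<close>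

lemma agree_orth:
  assumes "has_grid n 0 y" "has_grid n 0 y'" "\<And>i. \<bar>h $ i\<bar> \<le> int n"
  shows "y h = y' h \<longleftrightarrow> y (orth h) = y' (orth h)"
proof -
  define j where "j = h - orth h * psize s n"
  define j' where "j' = orth h - orth h * psize s n"
  have "0 \<le> j $ i \<and> j $ i < s $ i ^ n \<and> 0 \<le> j' $ i \<and> j' $ i < s $ i ^ n" for i
    using size_gt[of n i] assms(3)[of i] by (auto simp: j_def j'_def)
  then have "j \<in> box s n" "j' \<in> box s n" by (simp_all add: box_def)
  moreover have "h = orth h * psize s n + j + 0" "orth h = orth h * psize s n + j' + 0"
    by (simp_all add: j_def j'_def)
  ultimately show ?thesis using box_agree[OF assms(1,2)] by metis
qed

text \<open>All levels are available, so one can be chosen large enough for \<open>h\<close>. The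
  agreement set is thus a union of orthants.\<close>

lemma fixpts_agree:
  assumes "y \<in> fixpts" "y' \<in> fixpts"
  shows "y h = y' h \<longleftrightarrow> y (orth h) = y' (orth h)"
proof (rule agree_orth)
  let ?n = "nat (\<Sum>i\<in>UNIV. \<bar>h $ i\<bar>)"
  show "has_grid ?n 0 y" "has_grid ?n 0 y'" using assms by (auto simp: fixpts_def)
  show "\<bar>h $ i\<bar> \<le> int ?n" for i
    using member_le_sum[of i UNIV "\<lambda>i. \<bar>h $ i\<bar>"] by (simp add: sum_nonneg)
qed

lemma fixpts_eqI:
  assumes "y \<in> fixpts" "y' \<in> fixpts" "\<And>h. y (orth h) = y' (orth h)"
  shows "y = y'"
  using fixpts_agree[OF assms(1,2)] assms(3) by blast

lemma finite_range_orth: "finite (range (orth :: int ^ 'd \<Rightarrow> _))"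
proof (rule finite_subset)
  show "range (orth :: int ^ 'd \<Rightarrow> _) \<subseteq> {v. \<forall>i. v $ i \<in> {0, -1}}" by (auto split: if_splits)
  show "finite {v :: int ^ 'd. \<forall>i. v $ i \<in> {0, -1}}" by (rule finite_vec_box) simp
qed

text \<open>A point is determined by its letters at the finitely many corners
  \<open>orth h\<close>.\<close>

lemma finite_fixpts: "finite fixpts"
proof (rule inj_on_finite)
  show "inj_on (\<lambda>y. restrict y (range orth)) fixpts"
  proof (rule inj_onI)
    fix y y' assume y: "y \<in> fixpts" "y' \<in> fixpts" "restrict y (range orth) = restrict y' (range orth)"
    show "y = y'"
      using y(1,2)
    proof (rule fixpts_eqI)
      show "y (orth h) = y' (orth h)" for h using fun_cong[OF y(3), of "orth h"] by simp
    qed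
  qed
  show "(\<lambda>y. restrict y (range orth)) ` fixpts \<subseteq> PiE (range orth) (\<lambda>_. UNIV)" by auto
  show "finite (PiE (range (orth :: int ^ 'd \<Rightarrow> _)) (\<lambda>_. UNIV :: 'a set))"
    using finite_range_orth by (rule finite_PiE) simp
qed

text \<open>Floor division by \<open>s\<close> fixes the coordinates \<open>0\<close> and
  \<open>-1\<close>, so each corner letter evolves by itself, under its own column
  permutation.\<close>

lemma subst_inf_orth:
  "(subst_inf s \<theta> ^^ n) x (orth h) = ((\<lambda>a. \<theta> a (vmod (orth h) s)) ^^ n) (x (orth h))"
proof (induction n)
  case (Suc n)
  have "vdiv (orth h) s = orth h"
    using s_gt_1 by (simp add: vec_eq_iff vdiv_def div_eq_minus1 less_imp_neq order_less_trans[OF zero_less_one])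
  then show ?case using Suc by (simp add: subst_inf_def)
qed simp

lemma subst_inf_orth_period:
  obtains p where "p > 0" "\<And>x h n. (subst_inf s \<theta> ^^ (p * n)) x (orth h) = x (orth h)"
proof -
  obtain p where p: "p > 0" "\<And>f :: 'a \<Rightarrow> 'a. bij f \<Longrightarrow> f ^^ p = id"
    using funpow_common_period by blast
  have "(f ^^ (p * n)) = id" if "bij f" for f :: "'a \<Rightarrow> 'a" and n
    using p(2)[OF that] by (simp add: funpow_mult[symmetric] id_funpow)
  from this[OF bij_letter[OF vmod_in_box1]] show thesis
    using p(1) that[of p] by (simp add: subst_inf_orth)
qed

text \<open>The corner letters can be prescribed freely. Along multiples of the common period
  \<open>p\<close> those of the iterates stay constant, so the iterates are eventually constant at
  each position, and their pointwise limit has all grids.\<close>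

lemma fixpts_extend:
  fixes u :: "('a, 'd) config"
  obtains y where "y \<in> fixpts" "\<And>h. y (orth h) = u (orth h)"
proof -
  obtain p where p: "p > 0" "\<And>x h n. (subst_inf s \<theta> ^^ (p * n)) x (orth h) = x (orth h)"
    using subst_inf_orth_period by blast
  define v where "v = (\<lambda>N. (subst_inf s \<theta> ^^ (p * N)) u)"
  define K where "K = (\<lambda>h :: int ^ 'd. nat (\<Sum>i\<in>UNIV. \<bar>h $ i\<bar>))"
  \<comment> \<open>The limit is read off diagonally: all \<open>v N\<close> with
    \<open>N \<ge> K h\<close> agree at \<open>h\<close>, because \<open>K h\<close> bounds the
    coordinates of \<open>h\<close>.\<close>
  define y where "y = (\<lambda>h. v (K h) h)"
  have v: "has_grid n 0 (v N)" if "n \<le> N" for n N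
  proof -
    have "n \<le> p * N" using that p(1) by (cases p) (auto intro: le_trans)
    then show ?thesis unfolding v_def by (rule has_grid_subst_inf)
  qed
  have yv: "y h = v N h" if "K h \<le> N" for N h
  proof -
    have "v (K h) h = v N h \<longleftrightarrow> v (K h) (orth h) = v N (orth h)"
    proof (rule agree_orth)
      show "has_grid (K h) 0 (v (K h))" "has_grid (K h) 0 (v N)" using v that by auto
      show "\<bar>h $ i\<bar> \<le> int (K h)" for i
        using member_le_sum[of i UNIV "\<lambda>i. \<bar>h $ i\<bar>"] by (simp add: K_def sum_nonneg)
    qed
    then show ?thesis using p(2) by (simp add: y_def v_def)
  qed
  have "has_grid n 0 y" for n
  proof (rule has_grid_local_limit)
    fix U :: "(int ^ 'd) set" assume U: "finite U"
    define N where "N = n + sum K U"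
    have "K h \<le> N" if "h \<in> U" for h
      using member_le_sum[OF that _ U, of K] by (simp add: N_def)
    then have "\<forall>h\<in>U. y h = v N h" using yv by blast
    moreover have "has_grid n 0 (v N)" by (rule v) (simp add: N_def)
    ultimately show "\<exists>w. has_grid n 0 w \<and> (\<forall>h\<in>U. y h = w h)" by blast
  qed
  then have "y \<in> fixpts" by (simp add: fixpts_def)
  moreover have "y (orth h) = u (orth h)" for h using p(2) by (simp add: y_def v_def)
  ultimately show thesis using that by blast
qed

lemma fixpts_subst_inf:
  assumes "y \<in> fixpts"
  shows "subst_inf s \<theta> y \<in> fixpts"
proof -
  have "has_grid n 0 (subst_inf s \<theta> y)" for n
  proof -
    have "has_grid (Suc n) 0 (subst_inf s \<theta> y)"
      unfolding has_grid_def
    proof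
      fix m
      obtain a where a: "\<And>j. j \<in> box s n \<Longrightarrow> y (m * psize s n + j) = \<Theta> n a j"
        using assms unfolding fixpts_def has_grid_def by (simp, metis)
      have "subst_inf s \<theta> y (m * psize s (Suc n) + j + 0) = \<Theta> (Suc n) a j" if "j \<in> box s (Suc n)" for j
        using that a[OF vdiv_in_box] by (simp add: subst_inf_def vdiv_step vmod_step)
      then show "\<exists>a. \<forall>j\<in>box s (Suc n). subst_inf s \<theta> y (m * psize s (Suc n) + j + 0) = \<Theta> (Suc n) a j"
        by blast
    qed
    then show ?thesis by (rule has_grid_Suc)
  qed
  then show ?thesis by (simp add: fixpts_def)
qed

lemma fixpts_funpow: "y \<in> fixpts \<Longrightarrow> (subst_inf s \<theta> ^^ n) y \<in> fixpts"
  by (induction n) (auto intro: fixpts_subst_inf)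

text \<open>After a multiple of \<open>p\<close> steps the corner letters are restored, and they
  determine the point.\<close>

lemma fixpts_periodic:
  obtains p where "p > 0" "\<And>y n. y \<in> fixpts \<Longrightarrow> (subst_inf s \<theta> ^^ (p * n)) y = y"
proof -
  obtain p where p: "p > 0" "\<And>x h n. (subst_inf s \<theta> ^^ (p * n)) x (orth h) = x (orth h)"
    using subst_inf_orth_period by blast
  show thesis using that[of p] p by (blast intro: fixpts_eqI fixpts_funpow)
qed

end

section \<open>Closed shift-invariant sets\<close>

lemma topspace_full_shift [simp]: "topspace full_shift = UNIV"
  by (simp add: full_shift_def)

lemma compact_space_full_shift: "compact_space (full_shift :: ('a::finite, 'd::finite) config topology)"
  unfolding full_shift_def by (auto simp: compact_space_product_topology compact_space_discrete_topology)

lemma Hausdorff_space_full_shift: "Hausdorff_space full_shift"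
  unfolding full_shift_def by (simp add: Hausdorff_space_product_topology)

text \<open>Translates the product topology into finite windows, the form used in all local
  arguments.\<close>

lemma openin_full_shift:
  "openin full_shift V \<longleftrightarrow> (\<forall>x\<in>V. \<exists>U. finite U \<and> (\<forall>w. (\<forall>h\<in>U. w h = x h) \<longrightarrow> w \<in> V))"
  (is "_ \<longleftrightarrow> (\<forall>x\<in>V. ?P x)")
proof -
  have "(\<exists>W. finite {h. W h \<noteq> UNIV} \<and> x \<in> Pi\<^sub>E UNIV W \<and> Pi\<^sub>E UNIV W \<subseteq> V) \<longleftrightarrow> ?P x" for x
  proof
    assume "\<exists>W. finite {h. W h \<noteq> UNIV} \<and> x \<in> Pi\<^sub>E UNIV W \<and> Pi\<^sub>E UNIV W \<subseteq> V"
    then obtain W where W: "finite {h. W h \<noteq> UNIV}" "x \<in> Pi\<^sub>E UNIV W" "Pi\<^sub>E UNIV W \<subseteq> V"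
      by blast
    have "w \<in> V" if "\<forall>h\<in>{h. W h \<noteq> UNIV}. w h = x h" for w
    proof -
      have "w h \<in> W h" for h using that W(2) by (cases "W h = UNIV") (auto simp: PiE_iff)
      then show ?thesis using W(3) by auto
    qed
    then show "?P x" using W(1) by blast
  next
    assume "?P x"
    then obtain U where U: "finite U" "\<And>w. (\<forall>h\<in>U. w h = x h) \<Longrightarrow> w \<in> V" by blast
    have "finite {h. (if h \<in> U then {x h} else UNIV) \<noteq> UNIV}"
      by (rule finite_subset[OF _ U(1)]) auto
    moreover have "Pi\<^sub>E UNIV (\<lambda>h. if h \<in> U then {x h} else UNIV) \<subseteq> V"
    proof
      fix w assume w: "w \<in> Pi\<^sub>E UNIV (\<lambda>h. if h \<in> U then {x h} else UNIV)"
      have "w h = x h" if "h \<in> U" for h using PiE_mem[OF w, of h] that by simp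
      then show "w \<in> V" using U(2) by blast
    qed
    ultimately show "\<exists>W. finite {h. W h \<noteq> UNIV} \<and> x \<in> Pi\<^sub>E UNIV W \<and> Pi\<^sub>E UNIV W \<subseteq> V"
      by (intro exI[of _ "\<lambda>h. if h \<in> U then {x h} else UNIV"]) auto
  qed
  then show ?thesis
    unfolding full_shift_def openin_product_topology_alt by simp
qed

lemma openin_cylinder: "finite U \<Longrightarrow> openin full_shift {w. \<forall>h\<in>U. w h = x h}"
  unfolding openin_full_shift by auto

lemma in_closure_full_shift:
  fixes x :: "('a, 'd::finite) config"
  shows "x \<in> full_shift closure_of S \<longleftrightarrow> (\<forall>U. finite U \<longrightarrow> (\<exists>w\<in>S. \<forall>h\<in>U. w h = x h))"
proof
  assume x: "x \<in> full_shift closure_of S"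
  show "\<forall>U. finite U \<longrightarrow> (\<exists>w\<in>S. \<forall>h\<in>U. w h = x h)"
  proof (intro allI impI)
    fix U :: "(int ^ 'd) set" assume "finite U"
    then have "\<exists>w. w \<in> S \<and> w \<in> {w. \<forall>h\<in>U. w h = x h}"
      using x openin_cylinder[of U x] unfolding in_closure_of
      by (elim conjE allE[of _ "{w. \<forall>h\<in>U. w h = x h}"]) simp
    then show "\<exists>w\<in>S. \<forall>h\<in>U. w h = x h" by blast
  qed
next
  assume *: "\<forall>U. finite U \<longrightarrow> (\<exists>w\<in>S. \<forall>h\<in>U. w h = x h)"
  show "x \<in> full_shift closure_of S"
    unfolding in_closure_of
  proof (intro conjI allI impI)
    fix T assume "x \<in> T \<and> openin full_shift T"
    then obtain U where "finite U" "\<And>w. (\<forall>h\<in>U. w h = x h) \<Longrightarrow> w \<in> T"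
      unfolding openin_full_shift by blast
    then show "\<exists>y. y \<in> S \<and> y \<in> T" using * by blast
  qed simp
qed

lemma finite_cube: "finite {h :: int ^ 'd::finite. \<forall>i. \<bar>h $ i\<bar> \<le> R}"
proof -
  have "{h :: int ^ 'd. \<forall>i. \<bar>h $ i\<bar> \<le> R} = {h. \<forall>i. h $ i \<in> {- R..R}}" by (auto simp: abs_le_iff) (smt (verit))+
  then show ?thesis using finite_vec_box[of "\<lambda>_::'d. {- R..R}"] by simp
qed

lemma finite_subset_cube:
  assumes "finite (U :: (int ^ 'd::finite) set)"
  obtains R :: int where "R \<ge> 0" "\<And>h i. h \<in> U \<Longrightarrow> \<bar>h $ i\<bar> \<le> R"
proof
  show "0 \<le> (\<Sum>h\<in>U. \<Sum>i\<in>UNIV. \<bar>h $ i\<bar>)" by (simp add: sum_nonneg)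
  show "\<bar>h $ i\<bar> \<le> (\<Sum>h\<in>U. \<Sum>i\<in>UNIV. \<bar>h $ i\<bar>)" if "h \<in> U" for h i
  proof -
    have "\<bar>h $ i\<bar> \<le> (\<Sum>i\<in>UNIV. \<bar>h $ i\<bar>)" by (rule member_le_sum) auto
    also have "\<dots> \<le> (\<Sum>h\<in>U. \<Sum>i\<in>UNIV. \<bar>h $ i\<bar>)"
      using that assms by (intro member_le_sum) (auto intro: sum_nonneg)
    finally show ?thesis .
  qed
qed

lemma shift_0 [simp]: "shift 0 x = x"
  by (simp add: shift_def)

lemma shift_shift [simp]: "shift g (shift h x) = shift (g + h) x"
  by (simp add: shift_def algebra_simps)

lemma mat_vec_minus: "(A :: int ^ 'd ^ 'd::finite) *v (- p) = - (A *v p)"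
  by (simp add: matrix_vector_mult_def vec_eq_iff sum_negf)

section \<open>The group of extended symmetries\<close>

locale faithful_subshift =
  fixes X :: "('a::finite, 'd::finite) config set"
  assumes closed: "closedin full_shift X"
    and shift_in: "x \<in> X \<Longrightarrow> shift g x \<in> X"
    and faithful: "faithful_shift_action X"
begin

definition equivariant :: "(('a, 'd) config \<Rightarrow> ('a, 'd) config) \<Rightarrow> int ^ 'd ^ 'd \<Rightarrow> bool" where
  "equivariant f A \<longleftrightarrow> (\<forall>p. \<forall>x\<in>X. f (shift p x) = shift (A *v p) (f x))"

lemma equivariantD: "equivariant f A \<Longrightarrow> x \<in> X \<Longrightarrow> f (shift p x) = shift (A *v p) (f x)"
  by (simp add: equivariant_def)

lemma compact_X: "compactin full_shift X"
  using closed compact_space_full_shift by (rule closedin_compact_space[rotated])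

text \<open>A continuous bijection of a compact Hausdorff space is a homeomorphism. Hence
  automorphisms are the extended symmetries that commute with the shifts
  (\<open>Aut_iff\<close>).\<close>

lemma continuous_bij_homeomorphic:
  assumes "f \<in> Bij X" "continuous_map (subtopology full_shift X) (subtopology full_shift X) f"
  shows "homeomorphic_map (subtopology full_shift X) (subtopology full_shift X) f"
proof (rule continuous_imp_homeomorphic_map)
  show "compact_space (subtopology full_shift X)" using compact_X by (simp add: compact_space_subtopology)
  show "Hausdorff_space (subtopology full_shift X)"
    by (simp add: Hausdorff_space_subtopology Hausdorff_space_full_shift)
  show "f ` topspace (subtopology full_shift X) = topspace (subtopology full_shift X)"
    "inj_on f (topspace (subtopology full_shift X))"
    using assms(1) by (auto simp: Bij_def bij_betw_def)
qed (use assms in auto)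

text \<open>The inverse \<open>B\<close> is named because its rows will be the normals of the images
  of coordinate hyperplanes.\<close>

lemma SymE:
  assumes "f \<in> Sym_set X"
  obtains A B where "f \<in> Bij X" "continuous_map (subtopology full_shift X) (subtopology full_shift X) f"
    "A ** B = mat 1" "B ** A = mat 1" "equivariant f A"
  using assms unfolding Sym_set_def invertible_def equivariant_def by blast

lemma SymI:
  assumes "f \<in> Bij X" "continuous_map (subtopology full_shift X) (subtopology full_shift X) f"
    "A ** B = mat 1" "B ** A = mat 1" "equivariant f A"
  shows "f \<in> Sym_set X"
  using assms unfolding Sym_set_def invertible_def equivariant_def by blast

lemma Sym_in: "f \<in> Sym_set X \<Longrightarrow> x \<in> X \<Longrightarrow> f x \<in> X"
  using Bij_imp_funcset by (auto simp: Sym_set_def)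

lemma Sym_inj: "f \<in> Sym_set X \<Longrightarrow> inj_on f X"
  by (auto simp: Sym_set_def Bij_def bij_betw_def)

lemma Sym_surj: "f \<in> Sym_set X \<Longrightarrow> f ` X = X"
  by (auto simp: Sym_set_def Bij_def bij_betw_def)

lemma Sym_ext: "f \<in> Sym_set X \<Longrightarrow> f \<in> extensional X"
  by (auto simp: Sym_set_def Bij_def)

lemma inverse_equivariant:
  assumes f: "f \<in> Sym_set X" and A: "A ** B = mat 1" "equivariant f A"
    and g: "\<And>x. x \<in> X \<Longrightarrow> g (f x) = x"
  shows "equivariant g B"
  unfolding equivariant_def
proof (intro allI ballI)
  fix p x assume "x \<in> X"
  then obtain y where y: "y \<in> X" "x = f y" using Sym_surj[OF f] by blast
  have "A *v (B *v p) = p" by (simp add: matrix_vector_mul_assoc A)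
  then have "shift p x = f (shift (B *v p) y)" using y A(2) by (simp add: equivariantD)
  then show "g (shift p x) = shift (B *v p) (g x)" using y g shift_in by simp
qed

lemma inverse_in_Sym:
  assumes f: "f \<in> Sym_set X"
  shows "restrict (inv_into X f) X \<in> Sym_set X"
proof -
  obtain A B where AB: "f \<in> Bij X" "continuous_map (subtopology full_shift X) (subtopology full_shift X) f"
    "A ** B = mat 1" "B ** A = mat 1" "equivariant f A"
    using SymE[OF f] by metis
  let ?g = "restrict (inv_into X f) X"
  have gf: "?g (f x) = x" if "x \<in> X" for x
    using that Sym_in[OF f that] Sym_inj[OF f] by simp
  obtain g where g: "continuous_map (subtopology full_shift X) (subtopology full_shift X) g"
      "\<And>x. x \<in> X \<Longrightarrow> g (f x) = x"
    using continuous_bij_homeomorphic[OF AB(1,2)]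
    by (auto simp: homeomorphic_map_maps homeomorphic_maps_def)
  have "continuous_map (subtopology full_shift X) (subtopology full_shift X) ?g"
  proof (rule continuous_map_eq[OF g(1)])
    fix x assume "x \<in> topspace (subtopology full_shift X)"
    then obtain y where "y \<in> X" "x = f y" using Sym_surj[OF f] by auto
    then show "g x = ?g x" using g(2) gf by simp
  qed
  then show ?thesis
    using AB(3,4) inverse_equivariant[OF f AB(3,5) gf] restrict_inv_into_Bij[OF AB(1)]
    by (intro SymI[of ?g B A])
qed

lemma compose_in_Sym:
  assumes "f \<in> Sym_set X" "g \<in> Sym_set X"
  shows "compose X f g \<in> Sym_set X"
proof -
  obtain A B where f: "f \<in> Bij X" "continuous_map (subtopology full_shift X) (subtopology full_shift X) f"
    "A ** B = mat 1" "B ** A = mat 1" "equivariant f A"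
    using SymE[OF assms(1)] by metis
  obtain A' B' where g: "g \<in> Bij X" "continuous_map (subtopology full_shift X) (subtopology full_shift X) g"
    "A' ** B' = mat 1" "B' ** A' = mat 1" "equivariant g A'"
    using SymE[OF assms(2)] by metis
  show ?thesis
  proof (rule SymI)
    show "compose X f g \<in> Bij X" using f(1) g(1) by (rule compose_Bij)
    have "continuous_map (subtopology full_shift X) (subtopology full_shift X) (f \<circ> g)"
      using g(2) f(2) by (rule continuous_map_compose)
    then show "continuous_map (subtopology full_shift X) (subtopology full_shift X) (compose X f g)"
      by (rule continuous_map_eq) (simp add: compose_def)
    have "(A ** A') ** (B' ** B) = A ** (A' ** B') ** B" by (simp add: matrix_mul_assoc)
    then show "(A ** A') ** (B' ** B) = mat 1" using f g by simp
    have "(B' ** B) ** (A ** A') = B' ** (B ** A) ** A'" by (simp add: matrix_mul_assoc)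
    then show "(B' ** B) ** (A ** A') = mat 1" using f g by simp
    show "equivariant (compose X f g) (A ** A')"
      unfolding equivariant_def using Sym_in[OF assms(2)] shift_in
      by (simp add: compose_def equivariantD[OF f(5)] equivariantD[OF g(5)] matrix_vector_mul_assoc)
  qed
qed

lemma id_in_Sym: "(\<lambda>x\<in>X. x) \<in> Sym_set X"
proof (rule SymI)
  show "(\<lambda>x\<in>X. x) \<in> Bij X" by (rule id_Bij)
  show "continuous_map (subtopology full_shift X) (subtopology full_shift X) (\<lambda>x\<in>X. x)"
    by (rule continuous_map_eq[OF continuous_map_id]) auto
  show "mat 1 ** mat 1 = (mat 1 :: int ^ 'd ^ 'd)" by simp
  then show "mat 1 ** mat 1 = (mat 1 :: int ^ 'd ^ 'd)" .
  show "equivariant (\<lambda>x\<in>X. x) (mat 1)" by (simp add: equivariant_def shift_in)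
qed

lemma subgroup_Sym: "subgroup (Sym_set X) (BijGroup X)"
proof (rule group.subgroupI[OF group_BijGroup])
  show "Sym_set X \<subseteq> carrier (BijGroup X)" by (auto simp: Sym_set_def BijGroup_def)
  show "Sym_set X \<noteq> {}" using id_in_Sym by blast
  fix f assume f: "f \<in> Sym_set X"
  then have "f \<in> Bij X" by (simp add: Sym_set_def)
  then show "inv\<^bsub>BijGroup X\<^esub> f \<in> Sym_set X" using inverse_in_Sym[OF f] by (simp add: inv_BijGroup)
  fix g assume g: "g \<in> Sym_set X"
  then have "g \<in> Bij X" by (simp add: Sym_set_def)
  then show "f \<otimes>\<^bsub>BijGroup X\<^esub> g \<in> Sym_set X"
    using compose_in_Sym[OF f g] \<open>f \<in> Bij X\<close> by (simp add: BijGroup_def)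
qed

lemma group_Sym: "group (Sym_group X)"
  unfolding Sym_group_def using subgroup_Sym group_BijGroup by (rule subgroup.subgroup_is_group)

lemma carrier_Sym [simp]: "carrier (Sym_group X) = Sym_set X"
  by (simp add: Sym_group_def)

lemma mult_Sym:
  assumes "f \<in> Sym_set X" "g \<in> Sym_set X"
  shows "f \<otimes>\<^bsub>Sym_group X\<^esub> g = compose X f g"
  using assms by (simp add: Sym_group_def BijGroup_def Sym_set_def)

lemma one_Sym: "\<one>\<^bsub>Sym_group X\<^esub> = (\<lambda>x\<in>X. x)"
  by (simp add: Sym_group_def BijGroup_def)

lemma Aut_iff: "f \<in> Aut_set X \<longleftrightarrow> f \<in> Sym_set X \<and> (\<forall>p. \<forall>x\<in>X. f (shift p x) = shift p (f x))"
proof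
  assume f: "f \<in> Aut_set X"
  then have "equivariant f (mat 1)" by (simp add: Aut_set_def equivariant_def)
  then have "f \<in> Sym_set X" using f
    by (intro SymI[of _ "mat 1" "mat 1"]) (auto simp: Aut_set_def homeomorphic_imp_continuous_map)
  then show "f \<in> Sym_set X \<and> (\<forall>p. \<forall>x\<in>X. f (shift p x) = shift p (f x))"
    using f by (simp add: Aut_set_def)
next
  assume "f \<in> Sym_set X \<and> (\<forall>p. \<forall>x\<in>X. f (shift p x) = shift p (f x))"
  then show "f \<in> Aut_set X"
    using continuous_bij_homeomorphic[of f] by (auto simp: Aut_set_def Sym_set_def)
qed

text \<open>The Curtis-Hedlund-Lyndon argument: every point has a window that decides the letter of
  its image at \<open>0\<close>, and by compactness finitely many of the corresponding cylinders
  cover \<open>X\<close>.\<close>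

lemma continuous_local_0:
  assumes f: "continuous_map (subtopology full_shift X) (subtopology full_shift X) f"
  obtains R :: int where "R \<ge> 0"
    "\<And>x x'. x \<in> X \<Longrightarrow> x' \<in> X \<Longrightarrow> (\<And>h. (\<And>i. \<bar>h $ i\<bar> \<le> R) \<Longrightarrow> x h = x' h) \<Longrightarrow> f x 0 = f x' 0"
proof -
  have "\<exists>r\<ge>0. \<forall>w\<in>X. (\<forall>h. (\<forall>i. \<bar>h $ i\<bar> \<le> r) \<longrightarrow> w h = x h) \<longrightarrow> f w 0 = f x 0" if x: "x \<in> X" for x
  proof -
    have "openin full_shift {v. \<forall>h\<in>{0}. v h = f x h}" by (rule openin_cylinder) simp
    then have "openin (subtopology full_shift X) (X \<inter> {v. v 0 = f x 0})"
      by (simp add: openin_subtopology_Int2)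
    then have "openin (subtopology full_shift X)
        {w \<in> topspace (subtopology full_shift X). f w \<in> X \<inter> {v. v 0 = f x 0}}"
      using f by (rule openin_continuous_map_preimage[rotated])
    then obtain V where V: "openin full_shift V" "{w \<in> X. f w \<in> X \<inter> {v. v 0 = f x 0}} = V \<inter> X"
      unfolding openin_subtopology by auto
    have fX: "f w \<in> X" if "w \<in> X" for w
      using f that by (auto simp: continuous_map_def)
    have "x \<in> V" using V(2) x fX by blast
    then obtain U where U: "finite U" "\<And>w. (\<forall>h\<in>U. w h = x h) \<Longrightarrow> w \<in> V"
      using V(1) unfolding openin_full_shift by blast
    obtain r :: int where r: "r \<ge> 0" "\<And>h i. h \<in> U \<Longrightarrow> \<bar>h $ i\<bar> \<le> r"
      using finite_subset_cube[OF U(1)] by metis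
    have "f w 0 = f x 0" if "w \<in> X" "\<forall>h. (\<forall>i. \<bar>h $ i\<bar> \<le> r) \<longrightarrow> w h = x h" for w
    proof -
      have "w \<in> V" using that r(2) by (intro U(2)) blast
      then show ?thesis using that V(2) by blast
    qed
    then show ?thesis using r(1) by blast
  qed
  then obtain r where r: "\<And>x. x \<in> X \<Longrightarrow> r x \<ge> (0::int)"
    "\<And>x w. x \<in> X \<Longrightarrow> w \<in> X \<Longrightarrow> (\<And>h. (\<forall>i. \<bar>h $ i\<bar> \<le> r x) \<Longrightarrow> w h = x h) \<Longrightarrow> f w 0 = f x 0"
    by metis
  define C where "C = (\<lambda>x. {w :: ('a, 'd) config. \<forall>h\<in>{h. \<forall>i. \<bar>h $ i\<bar> \<le> r x}. w h = x h})"
  have "\<exists>\<F>. finite \<F> \<and> \<F> \<subseteq> C ` X \<and> X \<subseteq> \<Union>\<F>"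
  proof (rule compactinD[OF compact_X])
    fix V assume "V \<in> C ` X"
    then show "openin full_shift V" unfolding C_def using openin_cylinder[OF finite_cube] by blast
  next
    show "X \<subseteq> \<Union>(C ` X)" by (auto simp: C_def)
  qed
  then obtain F where F: "finite F" "F \<subseteq> X" "X \<subseteq> \<Union>(C ` F)"
    by (metis finite_subset_image)
  \<comment> \<open>The sum bounds every radius \<open>r x\<close> with \<open>x \<in> F\<close> and
    is meaningful for empty \<open>F\<close> as well.\<close>
  define R where "R = (\<Sum>x\<in>F. r x)"
  show thesis
  proof (rule that)
    show "R \<ge> 0" unfolding R_def using F(2) r(1) by (intro sum_nonneg) auto
    fix x x' assume x: "x \<in> X" "x' \<in> X" "\<And>h. (\<And>i. \<bar>h $ i\<bar> \<le> R) \<Longrightarrow> x h = x' h"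
    obtain c where c: "c \<in> F" "x \<in> C c" using F(3) x(1) by blast
    have rc: "r c \<le> R" unfolding R_def using F(1,2) c(1) r(1) by (intro member_le_sum) auto
    have xc: "x h = c h" if "\<forall>i. \<bar>h $ i\<bar> \<le> r c" for h using c(2) that by (simp add: C_def)
    have x'c: "x' h = c h" if "\<forall>i. \<bar>h $ i\<bar> \<le> r c" for h
      using xc[OF that] x(3)[of h] that rc by (metis order_trans)
    have "c \<in> X" using c(1) F(2) by blast
    then show "f x 0 = f x' 0" using r(2)[of c x] r(2)[of c x'] x(1,2) xc x'c by metis
  qed
qed

text \<open>As \<open>A *v (B *v n) = n\<close>, the letter of the image at \<open>n\<close> is the
  letter at \<open>0\<close> of the image of the point shifted by \<open>- (B *v n)\<close>; one
  radius therefore serves all \<open>n\<close>.\<close>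

lemma Sym_local:
  assumes f: "f \<in> Sym_set X" and A: "A ** B = mat 1" "equivariant f A"
  obtains R :: int where "R \<ge> 0"
    "\<And>x x' n. x \<in> X \<Longrightarrow> x' \<in> X \<Longrightarrow>
       (\<And>h. (\<And>i. \<bar>h $ i - (B *v n) $ i\<bar> \<le> R) \<Longrightarrow> x h = x' h) \<Longrightarrow> f x n = f x' n"
proof -
  have "continuous_map (subtopology full_shift X) (subtopology full_shift X) f"
    using f by (auto simp: Sym_set_def)
  then obtain R :: int where R: "R \<ge> 0"
    "\<And>x x'. x \<in> X \<Longrightarrow> x' \<in> X \<Longrightarrow> (\<And>h. (\<And>i. \<bar>h $ i\<bar> \<le> R) \<Longrightarrow> x h = x' h) \<Longrightarrow> f x 0 = f x' 0"
    using continuous_local_0 by metis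
  have fn: "f x n = f (shift (- (B *v n)) x) 0" if "x \<in> X" for x n
  proof -
    have "A *v (B *v (- n)) = - n" by (simp add: matrix_vector_mul_assoc A(1))
    then have "f (shift (- (B *v n)) x) = shift (- n) (f x)"
      using equivariantD[OF A(2) that] by (simp add: mat_vec_minus)
    then show ?thesis by (simp add: shift_def)
  qed
  show thesis
  proof (rule that[OF R(1)])
    fix x x' n assume x: "x \<in> X" "x' \<in> X" "\<And>h. (\<And>i. \<bar>h $ i - (B *v n) $ i\<bar> \<le> R) \<Longrightarrow> x h = x' h"
    have "f (shift (- (B *v n)) x) 0 = f (shift (- (B *v n)) x') 0"
    proof (rule R(2))
      fix h :: "int ^ 'd" assume "\<And>i. \<bar>h $ i\<bar> \<le> R"
      then show "shift (- (B *v n)) x h = shift (- (B *v n)) x' h"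
        unfolding shift_def by (intro x(3)) simp
    qed (use x shift_in in auto)
    then show "f x n = f x' n" using fn x(1,2) by simp
  qed
qed

end

section \<open>Limit points and the substitutive subshift\<close>

context bij_rect_subst
begin

text \<open>Iterates from the \<open>n\<close>-th on have a level-\<open>n\<close> grid at
  \<open>0\<close>, and so have their limits. Conversely, a point of \<open>fixpts\<close> recurs
  periodically in its own sequence of iterates.\<close>

lemma limit_points_eq_fixpts: "subst_limit_points s \<theta> = fixpts"
proof (intro equalityI subsetI)
  fix y assume "y \<in> subst_limit_points s \<theta>"
  then obtain x where x: "\<And>V. openin full_shift V \<Longrightarrow> y \<in> V \<Longrightarrow>
      \<exists>\<^sub>F k in sequentially. (subst_inf s \<theta> ^^ k) x \<in> V"
    unfolding subst_limit_points_def by blast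
  have "has_grid n 0 y" for n
  proof (rule has_grid_local_limit)
    fix U :: "(int ^ 'd) set" assume "finite U"
    then have "\<exists>\<^sub>F k in sequentially. (subst_inf s \<theta> ^^ k) x \<in> {w. \<forall>h\<in>U. w h = y h}"
      by (intro x openin_cylinder) auto
    then obtain k where "k \<ge> n" "\<forall>h\<in>U. (subst_inf s \<theta> ^^ k) x h = y h"
      unfolding frequently_sequentially by blast
    then show "\<exists>w. has_grid n 0 w \<and> (\<forall>h\<in>U. y h = w h)"
      using has_grid_subst_inf by (intro exI[of _ "(subst_inf s \<theta> ^^ k) x"]) auto
  qed
  then show "y \<in> fixpts" by (simp add: fixpts_def)
next
  fix y assume y: "y \<in> fixpts"
  obtain p where p: "p > 0" "\<And>y n. y \<in> fixpts \<Longrightarrow> (subst_inf s \<theta> ^^ (p * n)) y = y"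
    using fixpts_periodic by blast
  have "\<exists>\<^sub>F k in sequentially. (subst_inf s \<theta> ^^ k) y \<in> V" if "y \<in> V" for V
    unfolding frequently_sequentially
  proof
    fix n show "\<exists>k\<ge>n. (subst_inf s \<theta> ^^ k) y \<in> V"
      using that p y by (intro exI[of _ "p * n"]) auto
  qed
  then show "y \<in> subst_limit_points s \<theta>" unfolding subst_limit_points_def by blast
qed

lemma in_subst_shift_iff:
  "x \<in> subst_shift s \<theta> \<longleftrightarrow> (\<exists>y\<in>fixpts. \<forall>U. finite U \<longrightarrow> (\<exists>g. \<forall>h\<in>U. shift g y h = x h))"
  by (auto simp: subst_shift_def limit_points_eq_fixpts in_closure_full_shift)

lemma fixpts_in_subst_shift: "y \<in> fixpts \<Longrightarrow> y \<in> subst_shift s \<theta>"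
  unfolding in_subst_shift_iff by (metis shift_0)

lemma closedin_subst_shift: "closedin full_shift (subst_shift s \<theta>)"
  unfolding subst_shift_def limit_points_eq_fixpts using finite_fixpts by (intro closedin_Union) auto

lemma shift_in_subst_shift:
  assumes "x \<in> subst_shift s \<theta>"
  shows "shift g x \<in> subst_shift s \<theta>"
proof -
  obtain y where y: "y \<in> fixpts" "\<And>U. finite U \<Longrightarrow> \<exists>k. \<forall>h\<in>U. shift k y h = x h"
    using assms unfolding in_subst_shift_iff by blast
  have "\<exists>k. \<forall>h\<in>U. shift k y h = shift g x h" if U: "finite U" for U
  proof -
    obtain k where k: "\<And>h. h \<in> U \<Longrightarrow> shift k y (h - g) = x (h - g)"
      using y(2)[of "(\<lambda>h. h - g) ` U"] U by auto
    then have "\<forall>h\<in>U. shift (g + k) y h = shift g x h" by (simp add: shift_def algebra_simps)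
    then show ?thesis by blast
  qed
  then show ?thesis using y(1) unfolding in_subst_shift_iff by blast
qed

lemma subst_shift_has_grid:
  assumes "x \<in> subst_shift s \<theta>"
  shows "\<exists>k. has_grid n k x"
proof -
  obtain y where y: "y \<in> fixpts" "\<And>U. finite U \<Longrightarrow> \<exists>k. \<forall>h\<in>U. shift k y h = x h"
    using assms unfolding in_subst_shift_iff by blast
  have "has_grid n 0 y" using y(1) by (simp add: fixpts_def)
  moreover have "\<exists>g. \<forall>h\<in>U. x h = shift g y h" if "finite U" for U
    using y(2)[OF that] by metis
  ultimately show ?thesis by (rule has_grid_orbit_closure)
qed

end

section \<open>Fractures\<close>

definition dot :: "int ^ 'd::finite \<Rightarrow> int ^ 'd \<Rightarrow> int" where
  "dot b h = (\<Sum>j\<in>UNIV. b $ j * h $ j)"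

lemma mat_vec_nth: "(B *v h) $ i = dot (B $ i) h"
  by (simp add: dot_def matrix_vector_mult_def)

lemma dot_add: "dot b (g + h) = dot b g + dot b h"
  by (simp add: dot_def algebra_simps sum.distrib)

lemma dot_uminus: "dot (- b) h = - dot b h"
  by (simp add: dot_def sum_negf)

lemma dot_single:
  assumes "\<And>j. j \<noteq> q \<Longrightarrow> b $ j = 0"
  shows "dot b h = b $ q * h $ q"
proof -
  have "dot b h = (\<Sum>j\<in>{q}. b $ j * h $ j)"
    unfolding dot_def using assms by (intro sum.mono_neutral_right) auto
  then show ?thesis by simp
qed

text \<open>The centre \<open>t * b\<close> gains at least \<open>t\<close>, as
  \<open>dot b b \<ge> 1\<close> for a non-zero integer vector; moving within the cube loses at most
  \<open>\<bar>r\<bar>\<close> times the sum of the \<open>\<bar>b $ j\<bar>\<close>.\<close>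

lemma thick_halfspace:
  assumes "b \<noteq> 0"
  shows "thick {h. R \<le> dot b h}"
  unfolding thick_def
proof
  fix r :: int
  define t where "t = \<bar>R\<bar> + \<bar>r\<bar> * (\<Sum>j\<in>UNIV. \<bar>b $ j\<bar>)"
  have t: "t \<ge> 0" by (simp add: t_def sum_nonneg)
  obtain l where "b $ l \<noteq> 0" using assms by (auto simp: vec_eq_iff)
  then have "0 < b $ l * b $ l" by (auto simp: zero_less_mult_iff linorder_neq_iff)
  moreover have "b $ l * b $ l \<le> dot b b" unfolding dot_def by (rule member_le_sum) auto
  ultimately have bb: "1 \<le> dot b b" by linarith
  have "R \<le> dot b h" if h: "\<forall>i. \<bar>h $ i - (\<chi> i. t * b $ i) $ i\<bar> \<le> r" for h
  proof -
    have "- (\<bar>b $ j\<bar> * \<bar>r\<bar>) \<le> b $ j * (h $ j - t * b $ j)" for j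
    proof -
      have "\<bar>b $ j * (h $ j - t * b $ j)\<bar> \<le> \<bar>b $ j\<bar> * \<bar>r\<bar>"
        using h[rule_format, of j] unfolding abs_mult by (intro mult_left_mono) auto
      then show ?thesis by linarith
    qed
    then have "(\<Sum>j\<in>UNIV. - (\<bar>b $ j\<bar> * \<bar>r\<bar>)) \<le> (\<Sum>j\<in>UNIV. b $ j * (h $ j - t * b $ j))"
      by (rule sum_mono)
    also have "\<dots> = dot b h - t * dot b b"
      by (simp add: dot_def algebra_simps sum_subtractf sum_distrib_left)
    finally have "t * dot b b - \<bar>r\<bar> * (\<Sum>j\<in>UNIV. \<bar>b $ j\<bar>) \<le> dot b h"
      by (simp add: sum_negf sum_distrib_left mult.commute)
    moreover have "t \<le> t * dot b b" using mult_left_mono[OF bb t] by simp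
    ultimately show ?thesis unfolding t_def by linarith
  qed
  then show "\<exists>c. \<forall>h. (\<forall>i. \<bar>h $ i - c $ i\<bar> \<le> r) \<longrightarrow> h \<in> {h. R \<le> dot b h}" by blast
qed

lemma thick_mono: "thick S \<Longrightarrow> S \<subseteq> T \<Longrightarrow> thick T"
  unfolding thick_def by blast

locale prim_bij_subst = bij_rect_subst s \<theta>
  for s :: "int ^ 'd::finite" and \<theta> :: "'a::finite \<Rightarrow> int ^ 'd \<Rightarrow> 'a" +
  assumes primitive: "primitive_subst s \<theta>"
    and faithful_min: "faithful_shift_action (min_subst_shift s \<theta>)"
begin

abbreviation "X \<equiv> subst_shift s \<theta>"

lemma faithful_subst_shift: "faithful_shift_action X"
  unfolding faithful_shift_action_def
proof (intro allI impI)
  fix k :: "int ^ 'd" assume k: "\<forall>x\<in>X. shift k x = x"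
  obtain y where y: "y \<in> fixpts" using fixpts_extend by blast
  have "shift k y = y" using k fixpts_in_subst_shift[OF y] by blast
  then have "{h. y (h + - k) = y h} = UNIV" by (auto simp: shift_def dest: fun_cong)
  then have "thick {h. y (h + - k) = y h}" by (simp add: thick_def)
  moreover have "\<exists>k. has_grid n k y" for n using y by (auto simp: fixpts_def)
  ultimately show "k = 0"
    using no_local_period[OF primitive faithful_min, of y "- k"] by fastforce
qed

sublocale faithful_subshift X
  by unfold_locales (rule closedin_subst_shift shift_in_subst_shift faithful_subst_shift; assumption?)+

lemma two_letters: obtains a b :: 'a where "a \<noteq> b"
proof (rule ccontr)
  assume "\<not> thesis"
  then have "shift 1 x = x" for x :: "('a, 'd) config"
    using that by (intro ext) blast
  then have "(1 :: int ^ 'd) = 0" using faithful_min unfolding faithful_shift_action_def by blast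
  then show False by (simp add: vec_eq_iff)
qed

text \<open>The corner letters are kept on the side \<open>0 \<le> h $ i\<close> and changed on the
  other. Since \<open>orth h\<close> lies on the same side as \<open>h\<close>, the corners decide
  agreement everywhere.\<close>

lemma fixpts_fracture:
  assumes y: "y \<in> fixpts"
  obtains y' where "y' \<in> fixpts" "\<And>h. y h = y' h \<longleftrightarrow> 0 \<le> h $ i"
proof -
  obtain a b :: 'a where ab: "a \<noteq> b" by (rule two_letters)
  obtain y' where y': "y' \<in> fixpts"
    "\<And>h. y' (orth h) = (if 0 \<le> orth h $ i then y (orth h) else if y (orth h) = a then b else a)"
    using fixpts_extend[of "\<lambda>h. if 0 \<le> h $ i then y h else if y h = a then b else a"] by metis
  have "y h = y' h \<longleftrightarrow> 0 \<le> h $ i" for h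
    using fixpts_agree[OF y y'(1), of h] y'(2)[of h] ab by auto
  then show thesis using that y'(1) by blast
qed

lemma common_grid:
  assumes x: "x \<in> X" and T: "thick {h. x h = x' h}" and "has_grid n k x" "has_grid n k' x'"
  shows "has_grid n k x'"
  using grid_unique[OF primitive faithful_min subst_shift_has_grid[OF x] T assms(3,4)] assms(4)
  by (rule has_grid_cong[rotated])

text \<open>The offsets are congruent modulo \<open>s $ i ^ n\<close> for every \<open>n\<close>,
  and these moduli outgrow their difference.\<close>

lemma all_grids_unique:
  assumes x: "x \<in> X" and T: "thick {h. x h = x' h}"
    and "\<And>n. has_grid n t x" "\<And>n. has_grid n t' x'"
  shows "t = t'"
proof -
  have "t $ i = t' $ i" for i
  proof (rule ccontr)
    assume ne: "t $ i \<noteq> t' $ i"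
    let ?n = "nat \<bar>t $ i - t' $ i\<bar>"
    have "s $ i ^ ?n dvd t $ i - t' $ i"
      by (rule grid_unique[OF primitive faithful_min subst_shift_has_grid[OF x] T assms(3,4)])
    then have "\<bar>s $ i ^ ?n\<bar> \<le> \<bar>t $ i - t' $ i\<bar>" using ne by (intro dvd_imp_le_int) auto
    then show False using size_gt[of ?n i] by linarith
  qed
  then show ?thesis by (simp add: vec_eq_iff)
qed

text \<open>Describes the images of two points that agree exactly on a half-space. The conditions
  are asymmetric: locality of the symmetry gives agreement everywhere beyond depth \<open>R\<close>,
  locality of its inverse a difference within distance \<open>R\<close> of each position on the
  other side.\<close>

definition fractured :: "int ^ 'd \<Rightarrow> int \<Rightarrow> ('a, 'd) config \<Rightarrow> ('a, 'd) config \<Rightarrow> bool" where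
  "fractured b R x x' \<longleftrightarrow> (\<forall>h. R \<le> dot b h \<longrightarrow> x h = x' h) \<and>
     (\<forall>h. dot b h < 0 \<longrightarrow> (\<exists>g. (\<forall>l. \<bar>g $ l - h $ l\<bar> \<le> R) \<and> x g \<noteq> x' g))"

lemma fractured_cut:
  assumes k: "has_grid n k x" "has_grid n k x'" and fr: "fractured b R x x'"
    and R: "0 \<le> R" "\<And>j. 2 * R < s $ j ^ n" and p: "b $ p \<noteq> 0"
  obtains c where "\<And>j. s $ j ^ n dvd c $ j - k $ j"
    "(\<Sum>j\<in>UNIV. \<bar>b $ j\<bar> * (s $ j ^ n - 1 - R))
       \<le> dot b (c + (\<chi> j. if 0 < b $ j then s $ j ^ n - 1 else 0))"
    "dot b (c + (\<chi> j. if 0 < b $ j then s $ j ^ n - 1 else 0)) < R + \<bar>b $ p\<bar> * s $ p ^ n"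
proof -
  \<comment> \<open>\<open>c + u\<close> is the corner of the supertile at \<open>c\<close> with maximal \<open>dot b\<close>, and \<open>c + u'\<close> is the opposite
    corner, moved inwards so that its \<open>R\<close>-neighbourhood stays in the supertile. The position \<open>c\<close> moves
    along coordinate \<open>p\<close> only, so that \<open>dot b (c + u)\<close> runs through a progression of step \<open>M\<close>.\<close>
  define u where "u = (\<chi> j. if 0 < b $ j then s $ j ^ n - 1 else 0)"
  define u' where "u' = (\<chi> j. if 0 < b $ j then R else s $ j ^ n - 1 - R)"
  define D where "D = (\<Sum>j\<in>UNIV. \<bar>b $ j\<bar> * (s $ j ^ n - 1 - R))"
  define M where "M = \<bar>b $ p\<bar> * s $ p ^ n"
  have M: "0 < M" using p size_pos[of p n] by (simp add: M_def)
  \<comment> \<open>Moving by \<open>v div M\<close> steps, in the direction given by the sign of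
    \<open>b $ p\<close>, leaves the value \<open>R + v mod M\<close> at
    \<open>c + u\<close>.\<close>
  define v where "v = dot b (k + u) - R"
  define m where "m = (\<chi> j. if j = p then - sgn (b $ p) * (v div M) else 0)"
  define c where "c = m * psize s n + k"
  have "dot b (m * psize s n) = b $ p * (m * psize s n) $ p"
  proof -
    have "dot b (m * psize s n) = (\<Sum>j\<in>{p}. b $ j * (m * psize s n) $ j)"
      unfolding dot_def by (intro sum.mono_neutral_right) (auto simp: m_def)
    then show ?thesis by simp
  qed
  also have "\<dots> = - (v div M) * M"
    using abs_sgn[of "b $ p"] by (simp add: m_def M_def algebra_simps)
  finally have "dot b (c + u) = R + v mod M"
    using div_mult_mod_eq[of v M] by (simp add: c_def v_def dot_add algebra_simps)
  then have cu: "R \<le> dot b (c + u)" "dot b (c + u) < R + M"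
    using pos_mod_bound[OF M] pos_mod_sign[OF M] by auto
  have "dot b (c + u) - dot b (c + u') = D"
    unfolding D_def dot_def by (auto simp: u_def u'_def algebra_simps abs_if intro!: sum.cong simp flip: sum_subtractf)
  \<comment> \<open>Otherwise the supertile contains the agreeing position \<open>c + u\<close> and,
    within \<open>R\<close> of \<open>c + u'\<close>, a differing one, contrary to
    \<open>box_agree\<close>.\<close>
  moreover have "\<not> dot b (c + u') < 0"
  proof
    assume "dot b (c + u') < 0"
    then obtain g where g: "\<And>l. \<bar>g $ l - (c + u') $ l\<bar> \<le> R" "x g \<noteq> x' g"
      using fr unfolding fractured_def by blast
    have "x (c + u) = x' (c + u)" using cu fr unfolding fractured_def by blast
    moreover have "c + u = m * psize s n + u + k" "g = m * psize s n + (g - c) + k"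
      by (simp_all add: c_def algebra_simps)
    moreover have "u \<in> box s n" using size_pos by (simp add: box_def u_def)
    moreover have "g - c \<in> box s n"
    proof -
      have "0 \<le> (g - c) $ j \<and> (g - c) $ j < s $ j ^ n" for j
        using g(1)[of j] R(1) R(2)[of j] by (auto simp: u'_def abs_le_iff split: if_splits)
      then show ?thesis by (simp add: box_def)
    qed
    ultimately show False using box_agree[OF k, of u "g - c" m] g(2) by metis
  qed
  ultimately have "D \<le> dot b (c + u)" by linarith
  moreover have "\<And>j. s $ j ^ n dvd c $ j - k $ j" by (simp add: c_def)
  ultimately show thesis using that[of c] cu(2) unfolding D_def M_def u_def by blast
qed

text \<open>If two coordinates of \<open>b\<close> are non-zero, the lower bound in
  \<open>fractured_cut\<close> grows with both side lengths but the upper bound only with the one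
  along \<open>p\<close>, so they clash for large \<open>n\<close>.\<close>

lemma fractured_axis:
  assumes grids: "\<And>n. \<exists>k. has_grid n k x \<and> has_grid n k x'" and fr: "fractured b R x x'" and R: "0 \<le> R"
    and pq: "b $ p \<noteq> 0" "b $ q \<noteq> 0"
  shows "p = q"
proof (rule ccontr)
  assume ne: "p \<noteq> q"
  \<comment> \<open>Makes \<open>s $ q ^ n\<close> exceed the constants left after cancelling
    \<open>\<bar>b $ p\<bar> * s $ p ^ n\<close> in the two bounds, and also makes every side longer
    than \<open>2 * R\<close>.\<close>
  define n where "n = nat (\<bar>b $ p\<bar> * (1 + R) + 1 + 2 * R)"
  have n: "\<bar>b $ p\<bar> * (1 + R) + 1 + 2 * R < s $ j ^ n" for j
    using size_gt[of n j] unfolding n_def by linarith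
  have n2: "2 * R < s $ j ^ n" for j
    using n[of j] R by (smt (verit) mult_nonneg_nonneg abs_ge_zero)
  obtain k where k: "has_grid n k x" "has_grid n k x'" using grids by blast
  have c: "(\<Sum>j\<in>UNIV. \<bar>b $ j\<bar> * (s $ j ^ n - 1 - R)) < R + \<bar>b $ p\<bar> * s $ p ^ n"
    by (rule fractured_cut[OF k fr R n2 pq(1)]) (rule le_less_trans)
  have "(\<Sum>j\<in>{p, q}. \<bar>b $ j\<bar> * (s $ j ^ n - 1 - R)) \<le> (\<Sum>j\<in>UNIV. \<bar>b $ j\<bar> * (s $ j ^ n - 1 - R))"
  proof (rule sum_mono2)
    fix j show "0 \<le> \<bar>b $ j\<bar> * (s $ j ^ n - 1 - R)"
      using n2[of j] R by (intro mult_nonneg_nonneg) auto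
  qed auto
  then have "\<bar>b $ p\<bar> * (s $ p ^ n - 1 - R) + \<bar>b $ q\<bar> * (s $ q ^ n - 1 - R) < R + \<bar>b $ p\<bar> * s $ p ^ n"
    using c ne by simp
  moreover have "1 * (s $ q ^ n - 1 - R) \<le> \<bar>b $ q\<bar> * (s $ q ^ n - 1 - R)"
    using pq(2) n2[of q] R by (intro mult_right_mono) auto
  ultimately show False using n[of q] by (simp add: algebra_simps)
qed

text \<open>For a normal along an axis, the two bounds of \<open>fractured_cut\<close> confine a
  grid hyperplane to a neighbourhood of the origin whose size does not depend on
  \<open>n\<close>.\<close>

lemma fractured_offset:
  assumes k: "has_grid n k x" "has_grid n k x'" and fr: "fractured b R x x'"
    and R: "0 \<le> R" "\<And>j. 2 * R < s $ j ^ n"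
    and b: "\<bar>b $ q\<bar> = 1" "\<And>j. j \<noteq> q \<Longrightarrow> b $ j = 0"
  shows "\<exists>t. \<bar>t\<bar> \<le> R + 1 \<and> s $ q ^ n dvd t - k $ q"
proof -
  have bq: "b $ q \<noteq> 0" using b(1) by auto
  obtain c where c: "\<And>j. s $ j ^ n dvd c $ j - k $ j"
    "(\<Sum>j\<in>UNIV. \<bar>b $ j\<bar> * (s $ j ^ n - 1 - R))
       \<le> dot b (c + (\<chi> j. if 0 < b $ j then s $ j ^ n - 1 else 0))"
    "dot b (c + (\<chi> j. if 0 < b $ j then s $ j ^ n - 1 else 0)) < R + \<bar>b $ q\<bar> * s $ q ^ n"
    using fractured_cut[OF k fr R bq] by blast
  have "(\<Sum>j\<in>UNIV. \<bar>b $ j\<bar> * (s $ j ^ n - 1 - R)) = (\<Sum>j\<in>{q}. \<bar>b $ j\<bar> * (s $ j ^ n - 1 - R))"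
    using b(2) by (intro sum.mono_neutral_right) auto
  then have c2: "s $ q ^ n - 1 - R \<le> b $ q * (c $ q + (if 0 < b $ q then s $ q ^ n - 1 else 0))"
    "b $ q * (c $ q + (if 0 < b $ q then s $ q ^ n - 1 else 0)) < R + s $ q ^ n"
    using c(2,3) b(1) by (simp_all add: dot_single[OF b(2)])
  show ?thesis
  proof (cases "b $ q = 1")
    case True
    then show ?thesis using c2 c(1)[of q] by (intro exI[of _ "c $ q"]) auto
  next
    case False
    \<comment> \<open>The face near the fracture is now the far one, at
      \<open>c $ q + s $ q ^ n\<close>. This is the case that requires \<open>R + 1\<close> instead
      of \<open>R\<close>.\<close>
    then have "b $ q = -1" using b(1) by linarith
    moreover have "s $ q ^ n dvd (c $ q - k $ q) + s $ q ^ n"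
      using c(1)[of q] by (intro dvd_add) auto
    ultimately show ?thesis
      using c2 by (intro exI[of _ "c $ q + s $ q ^ n"]) (auto simp: algebra_simps)
  qed
qed

text \<open>A window around \<open>B *v n\<close> stays on one side of the hyperplane once
  \<open>dot (B $ i) n\<close> is large, so the local rule of \<open>f\<close> transfers agreement.
  If the images agreed near some \<open>n\<close> on the negative side, the local rule of the
  inverse would make the points agree at \<open>B *v n\<close>. In the last conclusion the extra
  \<open>1\<close> comes from the strict inequality \<open>h $ i < 0\<close>.\<close>

lemma Sym_fracture:
  assumes f: "f \<in> Sym_set X" and AB: "A ** B = mat 1" "B ** A = mat 1" "equivariant f A"
  obtains R where "0 \<le> R"
    "\<And>y y' i. y \<in> X \<Longrightarrow> y' \<in> X \<Longrightarrow> (\<And>h. y h = y' h \<longleftrightarrow> 0 \<le> h $ i) \<Longrightarrow> fractured (B $ i) R (f y) (f y')"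
    "\<And>y y' i. y \<in> X \<Longrightarrow> y' \<in> X \<Longrightarrow> (\<And>h. 0 \<le> h $ i \<Longrightarrow> y h = y' h) \<Longrightarrow>
       {h. R \<le> dot (B $ i) h} \<subseteq> {h. f y h = f y' h}"
    "\<And>y y' i. y \<in> X \<Longrightarrow> y' \<in> X \<Longrightarrow> (\<And>h. h $ i < 0 \<Longrightarrow> y h = y' h) \<Longrightarrow>
       {h. R + 1 \<le> dot (- (B $ i)) h} \<subseteq> {h. f y h = f y' h}"
proof -
  let ?g = "restrict (inv_into X f) X"
  have gf: "?g (f x) = x" if "x \<in> X" for x
    using that Sym_in[OF f that] Sym_inj[OF f] by simp
  obtain R0 :: int where R0: "R0 \<ge> 0" "\<And>x x' n. x \<in> X \<Longrightarrow> x' \<in> X \<Longrightarrow>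
       (\<And>h. (\<And>i. \<bar>h $ i - (B *v n) $ i\<bar> \<le> R0) \<Longrightarrow> x h = x' h) \<Longrightarrow> f x n = f x' n"
    using Sym_local[OF f AB(1,3)] by blast
  obtain R1 :: int where R1: "R1 \<ge> 0" "\<And>x x' n. x \<in> X \<Longrightarrow> x' \<in> X \<Longrightarrow>
       (\<And>h. (\<And>i. \<bar>h $ i - (A *v n) $ i\<bar> \<le> R1) \<Longrightarrow> x h = x' h) \<Longrightarrow> ?g x n = ?g x' n"
    using Sym_local[OF inverse_in_Sym[OF f] AB(2) inverse_equivariant[OF f AB(1,3) gf]] by blast
  define R where "R = max R0 R1"
  show thesis
  proof (rule that[of R])
    show "0 \<le> R" using R0(1) by (simp add: R_def)
    fix y y' i assume y: "y \<in> X" "y' \<in> X"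
    show agree: "{h. R \<le> dot (B $ i) h} \<subseteq> {h. f y h = f y' h}" if yi: "\<And>h. 0 \<le> h $ i \<Longrightarrow> y h = y' h"
    proof clarify
      fix n assume n: "R \<le> dot (B $ i) n"
      show "f y n = f y' n"
      proof (rule R0(2)[OF y])
        fix h :: "int ^ 'd" assume "\<And>i. \<bar>h $ i - (B *v n) $ i\<bar> \<le> R0"
        from this[of i] show "y h = y' h" using n by (intro yi) (simp add: mat_vec_nth R_def abs_le_iff)
      qed
    qed
    show "fractured (B $ i) R (f y) (f y')" if yi: "\<And>h. y h = y' h \<longleftrightarrow> 0 \<le> h $ i"
      unfolding fractured_def
    proof (intro conjI allI impI)
      show "f y n = f y' n" if "R \<le> dot (B $ i) n" for n
        using agree yi that by blast
    next
      fix n assume n: "dot (B $ i) n < 0"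
      show "\<exists>g. (\<forall>l. \<bar>g $ l - n $ l\<bar> \<le> R) \<and> f y g \<noteq> f y' g"
      proof (rule ccontr)
        assume *: "\<nexists>g. (\<forall>l. \<bar>g $ l - n $ l\<bar> \<le> R) \<and> f y g \<noteq> f y' g"
        have An: "A *v (B *v n) = n" by (simp add: matrix_vector_mul_assoc AB(1))
        have "?g (f y) (B *v n) = ?g (f y') (B *v n)"
        proof (rule R1(2))
          show "f y \<in> X" "f y' \<in> X" using Sym_in[OF f] y by auto
          fix h :: "int ^ 'd" assume h: "\<And>i. \<bar>h $ i - (A *v (B *v n)) $ i\<bar> \<le> R1"
          have "\<bar>h $ l - n $ l\<bar> \<le> R" for l using h[of l] by (simp add: An R_def)
          then show "f y h = f y' h" using * by blast
        qed
        then have "y (B *v n) = y' (B *v n)" using gf y by simp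
        then show False using yi n by (simp add: mat_vec_nth)
      qed
    qed
    show "{h. R + 1 \<le> dot (- (B $ i)) h} \<subseteq> {h. f y h = f y' h}" if yi: "\<And>h. h $ i < 0 \<Longrightarrow> y h = y' h"
    proof clarify
      fix n assume n: "R + 1 \<le> dot (- (B $ i)) n"
      show "f y n = f y' n"
      proof (rule R0(2)[OF y])
        fix h :: "int ^ 'd" assume "\<And>i. \<bar>h $ i - (B *v n) $ i\<bar> \<le> R0"
        from this[of i] show "y h = y' h" using n
          by (intro yi) (simp add: mat_vec_nth R_def abs_le_iff dot_uminus[of "B $ i"], linarith)
      qed
    qed
  qed
qed

lemma fractured_thick: "fractured b R x x' \<Longrightarrow> b \<noteq> 0 \<Longrightarrow> thick {h. x h = x' h}"
  by (rule thick_mono[OF thick_halfspace[of b R]]) (auto simp: fractured_def)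

text \<open>The rows of \<open>B\<close> are fracture normals, so \<open>fractured_axis\<close>
  leaves one non-zero entry in each, which is a unit because \<open>B\<close> has an integer
  inverse. \<open>fractured_offset\<close> then bounds the grid offsets in every direction, and
  gluing makes the offset independent of \<open>y\<close>.\<close>

theorem Sym_structure:
  assumes f: "f \<in> Sym_set X" and AB: "A ** B = mat 1" "B ** A = mat 1" "equivariant f A"
  obtains \<sigma> t where "bij \<sigma>" "\<And>i. \<bar>B $ i $ \<sigma> i\<bar> = 1" "\<And>i j. j \<noteq> \<sigma> i \<Longrightarrow> B $ i $ j = 0"
    "\<And>y. y \<in> fixpts \<Longrightarrow> shift (- t) (f y) \<in> fixpts"
proof (rule Sym_fracture[OF assms])
  fix R
  assume R: "0 \<le> R"
    "\<And>y y' i. y \<in> X \<Longrightarrow> y' \<in> X \<Longrightarrow> (\<And>h. y h = y' h \<longleftrightarrow> 0 \<le> h $ i) \<Longrightarrow> fractured (B $ i) R (f y) (f y')"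
    "\<And>y y' i. y \<in> X \<Longrightarrow> y' \<in> X \<Longrightarrow> (\<And>h. 0 \<le> h $ i \<Longrightarrow> y h = y' h) \<Longrightarrow>
       {h. R \<le> dot (B $ i) h} \<subseteq> {h. f y h = f y' h}"
    "\<And>y y' i. y \<in> X \<Longrightarrow> y' \<in> X \<Longrightarrow> (\<And>h. h $ i < 0 \<Longrightarrow> y h = y' h) \<Longrightarrow>
       {h. R + 1 \<le> dot (- (B $ i)) h} \<subseteq> {h. f y h = f y' h}"
  have BA: "(\<Sum>j\<in>UNIV. B $ i $ j * A $ j $ l) = (if i = l then 1 else 0)" for i l
    using arg_cong[OF AB(2), of "\<lambda>M. M $ i $ l"] by (simp add: matrix_matrix_mult_def mat_def)
  have B0: "B $ i \<noteq> 0" for i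
  proof
    assume "B $ i = 0"
    then show False using BA[of i i] by simp
  qed
  \<comment> \<open>The images of \<open>y\<close> and of its fracture partner agree on a thick set,
    hence share all grids.\<close>
  have frac: "\<exists>y'. y' \<in> X \<and> fractured (B $ i) R (f y) (f y') \<and>
      (\<forall>n k. has_grid n k (f y) \<longrightarrow> has_grid n k (f y'))" if y: "y \<in> fixpts" for y i
  proof -
    obtain y' where y': "y' \<in> fixpts" "\<And>h. y h = y' h \<longleftrightarrow> 0 \<le> h $ i"
      using fixpts_fracture[OF y] by metis
    have X: "y \<in> X" "y' \<in> X" using y y' fixpts_in_subst_shift by auto
    have fr: "fractured (B $ i) R (f y) (f y')" using R(2) X y'(2) by blast
    have "has_grid n k (f y')" if "has_grid n k (f y)" for n k
    proof -
      obtain k' where "has_grid n k' (f y')" using subst_shift_has_grid Sym_in[OF f X(2)] by blast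
      then show ?thesis using common_grid[OF Sym_in[OF f X(1)] fractured_thick[OF fr B0] that] by blast
    qed
    then show ?thesis using fr X by blast
  qed
  obtain y0 where y0: "y0 \<in> fixpts" using fixpts_extend by blast
  have single: "p = q" if "B $ i $ p \<noteq> 0" "B $ i $ q \<noteq> 0" for i p q
  proof -
    obtain y' where y': "y' \<in> X" "fractured (B $ i) R (f y0) (f y')"
      "\<And>n k. has_grid n k (f y0) \<Longrightarrow> has_grid n k (f y')"
      using frac[OF y0, of i] by blast
    show ?thesis
    proof (rule fractured_axis[OF _ y'(2) R(1) that])
      show "\<exists>k. has_grid n k (f y0) \<and> has_grid n k (f y')" for n
        using y'(3) subst_shift_has_grid[OF Sym_in[OF f fixpts_in_subst_shift[OF y0]], of n] by metis
    qed
  qed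
  have "\<exists>q. B $ i $ q \<noteq> 0" for i using B0[of i] by (auto simp: vec_eq_iff)
  then obtain \<sigma> where \<sigma>: "\<And>i. B $ i $ \<sigma> i \<noteq> 0" by metis
  have zero: "B $ i $ j = 0" if "j \<noteq> \<sigma> i" for i j using single \<sigma> that by blast
  have BA1: "B $ i $ \<sigma> i * A $ \<sigma> i $ l = (if i = l then 1 else 0)" for i l
  proof -
    have "(\<Sum>j\<in>UNIV. B $ i $ j * A $ j $ l) = (\<Sum>j\<in>{\<sigma> i}. B $ i $ j * A $ j $ l)"
      using zero by (intro sum.mono_neutral_right) auto
    then show ?thesis using BA[of i l] by simp
  qed
  have one: "\<bar>B $ i $ \<sigma> i\<bar> = 1" for i
    using BA1[of i i] by (simp add: zmult_eq_1_iff) auto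
  have "inj \<sigma>"
  proof (rule injI)
    fix i l assume eq: "\<sigma> i = \<sigma> l"
    show "i = l"
    proof (rule ccontr)
      assume "i \<noteq> l"
      then have "B $ i $ \<sigma> i * A $ \<sigma> i $ l = 0" by (simp add: BA1)
      then have "A $ \<sigma> l $ l = 0" using \<sigma>[of i] eq by simp
      then show False using BA1[of l l] by simp
    qed
  qed
  then have bij\<sigma>: "bij \<sigma>" by (simp add: bij_def finite_UNIV_inj_surj)
  \<comment> \<open>By \<open>fractured_offset\<close>, every high level has an offset in a finite
    set \<open>C\<close> that does not depend on the level. If each \<open>t\<close> failed at a
    level \<open>N t\<close>, a level above all \<open>N t\<close> with \<open>t \<in> C\<close>
    would have no offset in \<open>C\<close>, as grids pass to lower levels.\<close>
  have aligned: "\<exists>t. \<forall>n. has_grid n t (f y)" if y: "y \<in> fixpts" for y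
  proof (rule ccontr)
    assume "\<nexists>t. \<forall>n. has_grid n t (f y)"
    then obtain N where N: "\<And>t. \<not> has_grid (N t) t (f y)" by metis
    define C where "C = {t :: int ^ 'd. \<forall>i. \<bar>t $ i\<bar> \<le> R + 1}"
    have finC: "finite C" unfolding C_def by (rule finite_cube)
    define n where "n = nat (2 * R) + sum N C"
    have "2 * R \<le> int n" using R(1) by (simp add: n_def sum_nonneg)
    then have n: "2 * R < s $ j ^ n" for j using size_gt[of n j] by linarith
    obtain k where k: "has_grid n k (f y)"
      using subst_shift_has_grid[OF Sym_in[OF f fixpts_in_subst_shift[OF y]]] by blast
    have "\<exists>t. \<bar>t\<bar> \<le> R + 1 \<and> s $ q ^ n dvd t - k $ q" for q
    proof -
      obtain i where i: "q = \<sigma> i" using bij\<sigma> by (metis bij_pointE)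
      obtain y' where y': "fractured (B $ i) R (f y) (f y')" "has_grid n k (f y')"
        using frac[OF y, of i] k by blast
      show ?thesis
        unfolding i using fractured_offset[OF k y'(2,1) R(1) n one] zero by blast
    qed
    then obtain t where t: "\<And>q. \<bar>t q\<bar> \<le> R + 1" "\<And>q. s $ q ^ n dvd t q - k $ q" by metis
    define t' :: "int ^ 'd" where "t' = (\<chi> q. t q)"
    have t'C: "t' \<in> C" using t(1) by (simp add: C_def t'_def)
    have "has_grid n t' (f y)" using k by (rule has_grid_cong) (simp add: t'_def t)
    moreover have "N t' \<le> n" using member_le_sum[OF t'C _ finC, of N] by (simp add: n_def)
    ultimately show False using N has_grid_le by blast
  qed
  obtain t where t: "\<And>n. has_grid n t (f y0)" using aligned[OF y0] by blast
  have "shift (- t) (f y) \<in> fixpts" if y: "y \<in> fixpts" for y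
  proof -
    fix i0 :: 'd
    \<comment> \<open>The point \<open>y'\<close> is glued from \<open>y0\<close> and
      \<open>y\<close> along the hyperplane of \<open>i0\<close>. Its image agrees with each of
      theirs on a half-space, which makes all three offsets equal.\<close>
    obtain y' where y': "y' \<in> fixpts"
      "\<And>h. y' (orth h) = (if 0 \<le> orth h $ i0 then y0 (orth h) else y (orth h))"
      using fixpts_extend[of "\<lambda>h. if 0 \<le> h $ i0 then y0 h else y h"] by metis
    have a0: "y0 h = y' h" if "0 \<le> h $ i0" for h
      using fixpts_agree[OF y0 y'(1), of h] y'(2)[of h] that by simp
    have a1: "y h = y' h" if "h $ i0 < 0" for h
      using fixpts_agree[OF y y'(1), of h] y'(2)[of h] that by simp
    have X: "y0 \<in> X" "y \<in> X" "y' \<in> X" using y y0 y' fixpts_in_subst_shift by auto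
    obtain t1 where t1: "\<And>n. has_grid n t1 (f y')" using aligned[OF y'(1)] by blast
    obtain t2 where t2: "\<And>n. has_grid n t2 (f y)" using aligned[OF y] by blast
    have T2: "thick {h. f y h = f y' h}"
      using R(4)[OF X(2,3) a1] B0[of i0] by (intro thick_mono[OF thick_halfspace[of "- (B $ i0)" "R + 1"]]) auto
    have T1: "thick {h. f y0 h = f y' h}"
      using R(3)[OF X(1,3) a0] B0[of i0] by (intro thick_mono[OF thick_halfspace[of "B $ i0" R]]) auto
    have "t = t1" by (rule all_grids_unique[OF Sym_in[OF f X(1)] T1 t t1])
    moreover have "t2 = t1" by (rule all_grids_unique[OF Sym_in[OF f X(2)] T2 t2 t1])
    ultimately show ?thesis using t2 by (simp add: fixpts_def has_grid_shift)
  qed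
  then show thesis using that bij\<sigma> one zero by blast
qed

end

section \<open>The homomorphism to the hyperoctahedral group\<close>

text \<open>The sign belongs to the target coordinate and the permutation acts through its inverse,
  as in the semidirect product; this gives a left action (\<open>signed_perm_mult\<close>).\<close>

definition signed_perm :: "('d::finite \<Rightarrow> int) \<times> ('d \<Rightarrow> 'd) \<Rightarrow> int ^ 'd \<Rightarrow> int ^ 'd" where
  "signed_perm q p = (\<chi> i. (if fst q i = 0 then 1 else -1) * p $ (inv_into UNIV (snd q) i))"

lemma carrier_hyperoctahedral:
  "q \<in> carrier hyperoctahedral_group \<longleftrightarrow> (\<forall>i. fst q i = 0 \<or> fst q i = 1) \<and> bij (snd q)"
proof -
  have "0 \<le> z \<and> z < 2 \<longleftrightarrow> z = 0 \<or> z = 1" for z :: int by auto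
  then show ?thesis
    by (auto simp: hyperoctahedral_group_def semidirect_product_def BijGroup_def Bij_def
        carrier_integer_mod_group PiE_iff mem_Times_iff)
qed

lemma mult_hyperoctahedral:
  assumes "bij g" "bij h"
  shows "(a, g) \<otimes>\<^bsub>hyperoctahedral_group\<^esub> (b, h) = (\<lambda>i. (a i + b (inv_into UNIV g i)) mod 2, g \<circ> h)"
  using assms by (auto simp: hyperoctahedral_group_def semidirect_product_def BijGroup_def Bij_def compose_def)

lemma one_hyperoctahedral: "\<one>\<^bsub>hyperoctahedral_group\<^esub> = (\<lambda>_. 0, id)"
  by (auto simp: hyperoctahedral_group_def semidirect_product_def BijGroup_def)

lemma finite_carrier_hyperoctahedral:
  "finite (carrier (hyperoctahedral_group :: (('d::finite \<Rightarrow> int) \<times> ('d \<Rightarrow> 'd)) monoid))"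
proof (rule finite_subset)
  show "carrier hyperoctahedral_group \<subseteq> PiE UNIV (\<lambda>_ :: 'd. {0, 1 :: int}) \<times> (UNIV :: ('d \<Rightarrow> 'd) set)"
    using carrier_hyperoctahedral by (fastforce simp: PiE_iff)
  show "finite (PiE UNIV (\<lambda>_ :: 'd. {0, 1 :: int}) \<times> (UNIV :: ('d \<Rightarrow> 'd) set))"
    by (intro finite_cartesian_product finite_PiE) auto
qed

lemma signed_perm_one: "signed_perm \<one>\<^bsub>hyperoctahedral_group\<^esub> p = p"
  by (simp add: one_hyperoctahedral signed_perm_def)

lemma signed_perm_mult:
  assumes "q \<in> carrier hyperoctahedral_group" "q' \<in> carrier hyperoctahedral_group"
  shows "signed_perm (q \<otimes>\<^bsub>hyperoctahedral_group\<^esub> q') p = signed_perm q (signed_perm q' p)"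
proof -
  obtain a g b h where q: "q = (a, g)" "q' = (b, h)" by (metis surj_pair)
  have gh: "bij g" "bij h" and ab: "\<And>i. a i = 0 \<or> a i = 1" "\<And>i. b i = 0 \<or> b i = 1"
    using assms by (simp_all add: carrier_hyperoctahedral q)
  have "inv_into UNIV (g \<circ> h) = inv_into UNIV h \<circ> inv_into UNIV g"
    using gh by (simp add: o_inv_distrib)
  moreover have "(if (a i + b j) mod 2 = 0 then 1 else -1 :: int) =
      (if a i = 0 then 1 else -1) * (if b j = 0 then 1 else -1)" for i j
    using ab(1)[of i] ab(2)[of j] by auto
  ultimately show ?thesis
    by (simp add: q mult_hyperoctahedral gh signed_perm_def vec_eq_iff)
qed

text \<open>Testing on unit vectors recovers the permutation and then the signs. Membership in the
  carrier matters, since \<open>signed_perm\<close> only distinguishes zero from non-zero sign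
  components.\<close>

lemma signed_perm_inject:
  assumes "q \<in> carrier hyperoctahedral_group" "q' \<in> carrier hyperoctahedral_group"
    and eq: "\<And>p :: int ^ 'd::finite. signed_perm q p = signed_perm q' p"
  shows "q = q'"
proof -
  obtain a g b h where q: "q = (a, g)" "q' = (b, h)" by (metis surj_pair)
  have gh: "bij g" "bij h" and ab: "\<And>i. a i = 0 \<or> a i = 1" "\<And>i. b i = 0 \<or> b i = 1"
    using assms(1,2) by (simp_all add: carrier_hyperoctahedral q)
  have *: "(if a i = 0 then 1 else -1) * p $ inv_into UNIV g i
      = (if b i = 0 then 1 else -1) * p $ inv_into UNIV h i" for i and p :: "int ^ 'd"
    using arg_cong[OF eq[of p], of "\<lambda>v. v $ i"] by (simp add: signed_perm_def q)
  have inv: "inv_into UNIV g i = inv_into UNIV h i" for i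
    using *[of i "\<chi> j. if j = inv_into UNIV g i then 1 else 0"] by (auto split: if_splits)
  have "a i = b i" for i
    using *[of i "\<chi> j. if j = inv_into UNIV g i then 1 else 0"] inv[of i] ab(1)[of i] ab(2)[of i]
    by (auto split: if_splits)
  moreover have "g = h" using inv gh by (metis ext inv_inv_eq)
  ultimately show ?thesis by (auto simp: q)
qed

section \<open>Uniqueness of the induced matrix and the translation subgroup\<close>

context faithful_subshift
begin

text \<open>Shifting by \<open>F p - G p\<close> fixes every point of the image of \<open>f\<close>,
  which is all of \<open>X\<close>. \<open>F\<close> and \<open>G\<close> are arbitrary functions so
  that matrices and signed permutations can be compared alike.\<close>

lemma action_unique:
  assumes f: "f \<in> Sym_set X"
    and F: "\<And>p x. x \<in> X \<Longrightarrow> f (shift p x) = shift (F p) (f x)"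
    and G: "\<And>p x. x \<in> X \<Longrightarrow> f (shift p x) = shift (G p) (f x)"
  shows "F p = G p"
proof -
  have "shift (F p - G p) w = w" if "w \<in> X" for w
  proof -
    have "shift (- G p) w \<in> f ` X" using Sym_surj[OF f] shift_in that by simp
    then obtain x where x: "x \<in> X" "shift (- G p) w = f x" by blast
    have "shift (F p - G p) w = shift (F p) (f x)" unfolding x(2)[symmetric] by simp
    also have "\<dots> = shift (G p) (f x)" using F[OF x(1)] G[OF x(1)] by simp
    also have "\<dots> = w" unfolding x(2)[symmetric] by simp
    finally show ?thesis .
  qed
  then have "F p - G p = 0" using faithful unfolding faithful_shift_action_def by blast
  then show ?thesis by simp
qed

definition translation :: "int ^ 'd \<Rightarrow> ('a, 'd) config \<Rightarrow> ('a, 'd) config" where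
  "translation p = restrict (shift p) X"

lemma continuous_map_shift: "continuous_map full_shift full_shift (shift p)"
  unfolding full_shift_def continuous_map_componentwise_UNIV shift_def
  by (auto intro: continuous_map_product_projection)

lemma translation_in_Sym: "translation p \<in> Sym_set X"
proof (rule SymI)
  have "bij_betw (translation p) X X"
    by (rule bij_betw_byWitness[where f' = "shift (- p)"]) (auto simp: translation_def shift_in)
  then show "translation p \<in> Bij X" by (simp add: Bij_def translation_def)
  have "continuous_map (subtopology full_shift X) (subtopology full_shift X) (shift p)"
    by (intro continuous_map_into_subtopology continuous_map_from_subtopology continuous_map_shift)
      (auto simp: shift_in)
  then show "continuous_map (subtopology full_shift X) (subtopology full_shift X) (translation p)"
    by (rule continuous_map_eq) (simp add: translation_def)
  show "mat 1 ** mat 1 = (mat 1 :: int ^ 'd ^ 'd)" by simp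
  then show "mat 1 ** mat 1 = (mat 1 :: int ^ 'd ^ 'd)" .
  show "equivariant (translation p) (mat 1)"
    by (simp add: equivariant_def translation_def shift_in add.commute)
qed

lemma translation_mult:
  "translation p \<otimes>\<^bsub>Sym_group X\<^esub> translation q = translation (p + q)"
  unfolding mult_Sym[OF translation_in_Sym translation_in_Sym]
  by (auto simp: compose_def translation_def shift_in)

lemma translation_inj: "translation p = translation q \<Longrightarrow> p = q"
proof -
  assume eq: "translation p = translation q"
  have "shift (p - q) w = w" if "w \<in> X" for w
  proof -
    have "shift p (shift (- q) w) = shift q (shift (- q) w)"
      using fun_cong[OF eq, of "shift (- q) w"] shift_in[OF that] by (simp add: translation_def)
    then show ?thesis by simp
  qed
  then have "p - q = 0" using faithful unfolding faithful_shift_action_def by blast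
  then show "p = q" by simp
qed

lemma subgroup_translations: "subgroup (range translation) (Sym_group X)"
proof (rule group.subgroupI[OF group_Sym])
  show "range translation \<subseteq> carrier (Sym_group X)" using translation_in_Sym by auto
  fix f assume "f \<in> range translation"
  then obtain p where p: "f = translation p" by blast
  have "translation (- p) \<otimes>\<^bsub>Sym_group X\<^esub> translation p = \<one>\<^bsub>Sym_group X\<^esub>"
    unfolding translation_mult by (auto simp: translation_def one_Sym)
  then have "inv\<^bsub>Sym_group X\<^esub> f = translation (- p)"
    unfolding p by (intro group.inv_equality[OF group_Sym]) (auto simp: translation_in_Sym)
  then show "inv\<^bsub>Sym_group X\<^esub> f \<in> range translation" by simp
next
  fix f g assume "f \<in> range translation" "g \<in> range translation"
  then show "f \<otimes>\<^bsub>Sym_group X\<^esub> g \<in> range translation" by (auto simp: translation_mult)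
qed auto

lemma translations_iso:
  "(Sym_group X)\<lparr>carrier := range translation\<rparr> \<cong> product_group (UNIV :: 'd set) (\<lambda>_. integer_group)"
proof -
  let ?Z = "product_group (UNIV :: 'd set) (\<lambda>_. integer_group)"
  let ?T = "(Sym_group X)\<lparr>carrier := range translation\<rparr>"
  have "(\<lambda>a. translation (vec_lambda a)) \<in> iso ?Z ?T"
  proof (rule isoI)
    show "(\<lambda>a. translation (vec_lambda a)) \<in> hom ?Z ?T"
    proof (rule homI)
      fix a b :: "'d \<Rightarrow> int"
      have "vec_lambda (\<lambda>i. a i + b i) = vec_lambda a + vec_lambda b" by (simp add: vec_eq_iff)
      then show "translation (vec_lambda (a \<otimes>\<^bsub>?Z\<^esub> b)) = translation (vec_lambda a) \<otimes>\<^bsub>?T\<^esub> translation (vec_lambda b)"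
        by (simp add: translation_mult restrict_UNIV)
    qed auto
    have "inj (\<lambda>a. translation (vec_lambda a))"
      using translation_inj by (intro injI) (metis vec_lambda_inverse UNIV_I)
    moreover have "range (\<lambda>a. translation (vec_lambda a)) = range translation"
    proof -
      have "translation p = translation (vec_lambda (vec_nth p))" for p by (simp add: vec_nth_inverse)
      then show ?thesis by blast
    qed
    ultimately show "bij_betw (\<lambda>a. translation (vec_lambda a)) (carrier ?Z) (carrier ?T)"
      by (simp add: bij_betw_def PiE_UNIV_domain)
  qed
  then have "?Z \<cong> ?T" by (rule is_isoI)
  moreover have "group ?Z" by (simp add: group_integer_group)
  ultimately show ?thesis using group.iso_sym by blast
qed

end

section \<open>The image in the hyperoctahedral group and the finite index\<close>

context prim_bij_subst
begin

text \<open>\<open>Sym_structure\<close> describes the inverse \<open>B\<close>. Solving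
  \<open>B *v (A *v p) = p\<close> row by row shows that \<open>A\<close> moves coordinate
  \<open>i\<close> to \<open>\<sigma> i\<close> with the sign
  \<open>B $ i $ \<sigma> i\<close>.\<close>

lemma Sym_signed_perm:
  assumes f: "f \<in> Sym_set X"
  shows "\<exists>q\<in>carrier hyperoctahedral_group. \<forall>p. \<forall>x\<in>X. f (shift p x) = shift (signed_perm q p) (f x)"
proof -
  obtain A B where AB: "f \<in> Bij X" "A ** B = mat 1" "B ** A = mat 1" "equivariant f A"
    using SymE[OF f] by metis
  obtain \<sigma> where \<sigma>: "bij \<sigma>" "\<And>i. \<bar>B $ i $ \<sigma> i\<bar> = 1" "\<And>i j. j \<noteq> \<sigma> i \<Longrightarrow> B $ i $ j = 0"
    using Sym_structure[OF f AB(2-4)] by metis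
  define a where "a = (\<lambda>j. if B $ inv_into UNIV \<sigma> j $ j = 1 then 0 else 1 :: int)"
  have "A *v p = signed_perm (a, \<sigma>) p" for p
  proof -
    have BAp: "B $ i $ \<sigma> i * (A *v p) $ \<sigma> i = p $ i" for i
    proof -
      have "(B *v (A *v p)) $ i = p $ i" by (simp add: matrix_vector_mul_assoc AB(3))
      then show ?thesis using dot_single[of "\<sigma> i" "B $ i"] \<sigma>(3) by (simp add: mat_vec_nth)
    qed
    have "(A *v p) $ j = (if a j = 0 then 1 else -1) * p $ inv_into UNIV \<sigma> j" for j
    proof -
      have j: "\<sigma> (inv_into UNIV \<sigma> j) = j" using \<sigma>(1) by (simp add: bij_is_surj surj_f_inv_f)
      have "B $ inv_into UNIV \<sigma> j $ j = 1 \<or> B $ inv_into UNIV \<sigma> j $ j = -1"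
        using \<sigma>(2)[of "inv_into UNIV \<sigma> j"] unfolding j by linarith
      then show ?thesis using BAp[of "inv_into UNIV \<sigma> j"] unfolding j by (auto simp: a_def)
    qed
    then show ?thesis by (simp add: vec_eq_iff signed_perm_def)
  qed
  moreover have "(a, \<sigma>) \<in> carrier hyperoctahedral_group"
    using \<sigma>(1) by (simp add: carrier_hyperoctahedral a_def)
  ultimately show ?thesis using AB(4) unfolding equivariant_def by metis
qed

text \<open>The morphism to the general linear group, with its values read as signed permutations.
  The choice is unique by \<open>sym_perm_eqI\<close>.\<close>

definition sym_perm :: "(('a, 'd) config \<Rightarrow> ('a, 'd) config) \<Rightarrow> ('d \<Rightarrow> int) \<times> ('d \<Rightarrow> 'd)" where
  "sym_perm f = (SOME q. q \<in> carrier hyperoctahedral_group \<and>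
     (\<forall>p. \<forall>x\<in>X. f (shift p x) = shift (signed_perm q p) (f x)))"

lemma sym_perm:
  assumes "f \<in> Sym_set X"
  shows "sym_perm f \<in> carrier hyperoctahedral_group"
    "x \<in> X \<Longrightarrow> f (shift p x) = shift (signed_perm (sym_perm f) p) (f x)"
  using someI_ex[of "\<lambda>q. q \<in> carrier hyperoctahedral_group \<and>
     (\<forall>p. \<forall>x\<in>X. f (shift p x) = shift (signed_perm q p) (f x))"] Sym_signed_perm[OF assms]
  unfolding sym_perm_def by blast+

lemma sym_perm_eqI:
  assumes "f \<in> Sym_set X" "q \<in> carrier hyperoctahedral_group"
    and "\<And>p x. x \<in> X \<Longrightarrow> f (shift p x) = shift (signed_perm q p) (f x)"
  shows "sym_perm f = q"
  using sym_perm(1)[OF assms(1)] assms(2)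
proof (rule signed_perm_inject)
  show "signed_perm (sym_perm f) p = signed_perm q p" for p
    by (rule action_unique[OF assms(1) sym_perm(2)[OF assms(1)] assms(3)])
qed

lemma group_hom_sym_perm: "group_hom (Sym_group X) hyperoctahedral_group sym_perm"
proof (rule group_hom.intro[OF group_Sym group_hyperoctahedral_group group_hom_axioms.intro], rule homI)
  show "sym_perm f \<in> carrier hyperoctahedral_group" if "f \<in> carrier (Sym_group X)" for f
    using that sym_perm(1) by simp
  fix f g assume "f \<in> carrier (Sym_group X)" "g \<in> carrier (Sym_group X)"
  then have f: "f \<in> Sym_set X" and g: "g \<in> Sym_set X" by auto
  interpret Q: group hyperoctahedral_group by (rule group_hyperoctahedral_group)
  show "sym_perm (f \<otimes>\<^bsub>Sym_group X\<^esub> g) = sym_perm f \<otimes>\<^bsub>hyperoctahedral_group\<^esub> sym_perm g"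
    unfolding mult_Sym[OF f g]
  proof (rule sym_perm_eqI[OF compose_in_Sym[OF f g]])
    show "sym_perm f \<otimes>\<^bsub>hyperoctahedral_group\<^esub> sym_perm g \<in> carrier hyperoctahedral_group"
      using sym_perm(1) f g by blast
    fix p x assume x: "x \<in> X"
    then show "compose X f g (shift p x) =
        shift (signed_perm (sym_perm f \<otimes>\<^bsub>hyperoctahedral_group\<^esub> sym_perm g) p) (compose X f g x)"
      using shift_in[OF x] Sym_in[OF g x]
      by (simp add: compose_def sym_perm(2)[OF f] sym_perm(2)[OF g] signed_perm_mult sym_perm(1) f g)
  qed
qed

lemma kernel_sym_perm: "kernel (Sym_group X) hyperoctahedral_group sym_perm = Aut_set X"
proof (intro equalityI subsetI)
  fix f assume "f \<in> kernel (Sym_group X) hyperoctahedral_group sym_perm"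
  then have f: "f \<in> Sym_set X" "sym_perm f = \<one>\<^bsub>hyperoctahedral_group\<^esub>" by (auto simp: kernel_def)
  then show "f \<in> Aut_set X"
    using sym_perm(2)[OF f(1)] by (simp add: Aut_iff signed_perm_one)
next
  fix f assume "f \<in> Aut_set X"
  then have f: "f \<in> Sym_set X" "\<And>p x. x \<in> X \<Longrightarrow> f (shift p x) = shift p (f x)" by (auto simp: Aut_iff)
  interpret Q: group hyperoctahedral_group by (rule group_hyperoctahedral_group)
  have "sym_perm f = \<one>\<^bsub>hyperoctahedral_group\<^esub>"
    using f by (intro sym_perm_eqI) (auto simp: signed_perm_one)
  then show "f \<in> kernel (Sym_group X) hyperoctahedral_group sym_perm"
    using f(1) by (simp add: kernel_def)
qed

text \<open>Equal values of \<open>sym_perm\<close> mean equal matrices, so \<open>f\<close> and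
  \<open>g\<close> also agree on all translates of points of \<open>fixpts\<close>. These are dense
  in \<open>X\<close>, and both maps are local.\<close>

lemma Sym_eqI:
  assumes f: "f \<in> Sym_set X" and g: "g \<in> Sym_set X" and fg: "sym_perm f = sym_perm g"
    and fix_eq: "\<And>y. y \<in> fixpts \<Longrightarrow> f y = g y"
  shows "f = g"
proof (rule extensionalityI[OF Sym_ext[OF f] Sym_ext[OF g]])
  fix x assume x: "x \<in> X"
  obtain A B where AB: "A ** B = mat 1" "equivariant f A"
    using SymE[OF f] by metis
  have "A *v p = signed_perm (sym_perm f) p" for p
    by (rule action_unique[OF f equivariantD[OF AB(2)] sym_perm(2)[OF f]])
  then have g_eq: "equivariant g A"
    unfolding equivariant_def fg using sym_perm(2)[OF g] by simp
  obtain Rf :: int where "Rf \<ge> 0" and Rf: "\<And>x x' n. x \<in> X \<Longrightarrow> x' \<in> X \<Longrightarrow>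
       (\<And>h. (\<And>i. \<bar>h $ i - (B *v n) $ i\<bar> \<le> Rf) \<Longrightarrow> x h = x' h) \<Longrightarrow> f x n = f x' n"
    using Sym_local[OF f AB] by blast
  obtain Rg :: int where "Rg \<ge> 0" and Rg: "\<And>x x' n. x \<in> X \<Longrightarrow> x' \<in> X \<Longrightarrow>
       (\<And>h. (\<And>i. \<bar>h $ i - (B *v n) $ i\<bar> \<le> Rg) \<Longrightarrow> x h = x' h) \<Longrightarrow> g x n = g x' n"
    using Sym_local[OF g AB(1) g_eq] by blast
  show "f x = g x"
  proof
    fix n
    define R where "R = max Rf Rg"
    define U where "U = {h. \<forall>i. \<bar>h $ i - (B *v n) $ i\<bar> \<le> R}"
    have "U \<subseteq> (\<lambda>h. h + B *v n) ` {h. \<forall>i. \<bar>h $ i\<bar> \<le> R}"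
    proof
      fix h assume "h \<in> U"
      then have "h - B *v n \<in> {h. \<forall>i. \<bar>h $ i\<bar> \<le> R}" by (simp add: U_def)
      then show "h \<in> (\<lambda>h. h + B *v n) ` {h. \<forall>i. \<bar>h $ i\<bar> \<le> R}" by (rule rev_image_eqI) simp
    qed
    then have "finite U" using finite_cube finite_surj by blast
    then obtain y k where y: "y \<in> fixpts" "\<And>h. h \<in> U \<Longrightarrow> shift k y h = x h"
      using x unfolding in_subst_shift_iff by meson
    have yX: "y \<in> X" "shift k y \<in> X" using fixpts_in_subst_shift[OF y(1)] shift_in by auto
    have "f x n = f (shift k y) n"
      using y(2) by (intro Rf[OF x yX(2)]) (auto simp: U_def R_def le_max_iff_disj)
    also have "f (shift k y) = g (shift k y)"
      using equivariantD[OF AB(2) yX(1)] equivariantD[OF g_eq yX(1)] fix_eq[OF y(1)] by simp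
    also have "g (shift k y) n = g x n"
      using y(2) by (intro Rg[OF yX(2) x]) (auto simp: U_def R_def le_max_iff_disj)
    finally show "f x n = g x n" .
  qed
qed

text \<open>By \<open>Sym_eqI\<close>, such a symmetry is determined by an element of a finite group
  and a self-map of the finite set \<open>fixpts\<close>.\<close>

lemma finite_fixpts_preserving: "finite {f \<in> Sym_set X. \<forall>y\<in>fixpts. f y \<in> fixpts}"
proof (rule inj_on_finite)
  show "inj_on (\<lambda>f. (sym_perm f, restrict f fixpts)) {f \<in> Sym_set X. \<forall>y\<in>fixpts. f y \<in> fixpts}"
  proof (rule inj_onI)
    fix f g
    assume fg: "f \<in> {f \<in> Sym_set X. \<forall>y\<in>fixpts. f y \<in> fixpts}" "g \<in> {f \<in> Sym_set X. \<forall>y\<in>fixpts. f y \<in> fixpts}"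
      and eq: "(sym_perm f, restrict f fixpts) = (sym_perm g, restrict g fixpts)"
    have "f y = g y" if "y \<in> fixpts" for y
      using eq that by (metis Pair_inject restrict_apply')
    then show "f = g" using fg eq by (intro Sym_eqI) auto
  qed
  show "(\<lambda>f. (sym_perm f, restrict f fixpts)) ` {f \<in> Sym_set X. \<forall>y\<in>fixpts. f y \<in> fixpts}
      \<subseteq> carrier hyperoctahedral_group \<times> PiE fixpts (\<lambda>_. fixpts)"
    using sym_perm(1) by auto
  show "finite (carrier (hyperoctahedral_group :: (('d \<Rightarrow> int) \<times> ('d \<Rightarrow> 'd)) monoid) \<times> PiE fixpts (\<lambda>_. fixpts))"
    by (intro finite_cartesian_product finite_carrier_hyperoctahedral finite_PiE finite_fixpts)
qed

text \<open>Composing with the translation by \<open>- t\<close> from \<open>Sym_structure\<close>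
  replaces any symmetry by one in the same coset that preserves \<open>fixpts\<close>.\<close>

lemma finite_rcosets_translations: "finite (rcosets\<^bsub>Sym_group X\<^esub> (range translation))"
proof (rule finite_subset)
  let ?F = "{f \<in> Sym_set X. \<forall>y\<in>fixpts. f y \<in> fixpts}"
  let ?c = "\<lambda>f. range translation #>\<^bsub>Sym_group X\<^esub> f"
  show "finite (?c ` ?F)" using finite_fixpts_preserving by simp
  show "rcosets\<^bsub>Sym_group X\<^esub> (range translation) \<subseteq> ?c ` ?F"
  proof
    fix S assume "S \<in> rcosets\<^bsub>Sym_group X\<^esub> (range translation)"
    then obtain f where f: "f \<in> Sym_set X" "S = ?c f" by (auto simp: RCOSETS_def)
    obtain A B where AB: "A ** B = mat 1" "B ** A = mat 1" "equivariant f A"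
      using SymE[OF f(1)] by metis
    obtain t where t: "\<And>y. y \<in> fixpts \<Longrightarrow> shift (- t) (f y) \<in> fixpts"
      using Sym_structure[OF f(1) AB] by metis
    let ?g = "translation (- t) \<otimes>\<^bsub>Sym_group X\<^esub> f"
    have g: "?g \<in> Sym_set X" using f(1) by (simp add: mult_Sym translation_in_Sym compose_in_Sym)
    have "?g y \<in> fixpts" if "y \<in> fixpts" for y
      using t[OF that] fixpts_in_subst_shift[OF that] Sym_in[OF f(1)]
      unfolding mult_Sym[OF translation_in_Sym f(1)] by (simp add: compose_def translation_def)
    then have "?g \<in> ?F" using g by blast
    moreover have "S = ?c ?g"
      unfolding f(2) using f(1)
      by (intro group.repr_independence[OF group_Sym _ _ subgroup_translations])
        (auto simp: r_coset_def)
    ultimately show "S \<in> ?c ` ?F" by blast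
  qed
qed

text \<open>The first isomorphism theorem, with the codomain cut down to the image so that the
  morphism becomes surjective.\<close>

lemma quotient_hyperoctahedral:
  "subgroup (sym_perm ` Sym_set X) hyperoctahedral_group"
  "Sym_group X Mod Aut_set X \<cong> hyperoctahedral_group\<lparr>carrier := sym_perm ` Sym_set X\<rparr>"
proof -
  interpret P: group_hom "Sym_group X" hyperoctahedral_group sym_perm by (rule group_hom_sym_perm)
  let ?K = "hyperoctahedral_group\<lparr>carrier := sym_perm ` Sym_set X\<rparr>"
  show sub: "subgroup (sym_perm ` Sym_set X) hyperoctahedral_group"
    using P.img_is_subgroup by simp
  have "group ?K" using sub P.H.is_group by (rule subgroup.subgroup_is_group)
  then interpret K: group_hom "Sym_group X" ?K sym_perm
    using P.homh group_Sym by (intro group_hom.intro group_hom_axioms.intro) (auto simp: hom_def)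
  have "kernel (Sym_group X) ?K sym_perm = Aut_set X"
    using kernel_sym_perm by (simp add: kernel_def)
  then show "Sym_group X Mod Aut_set X \<cong> ?K" using K.FactGroup_iso by simp
qed

lemma Aut_normal: "Aut_set X \<lhd> Sym_group X"
  using group_hom.normal_kernel[OF group_hom_sym_perm] kernel_sym_perm by simp

end

theorem theorem18:
  fixes s :: "int ^ 'd::finite"
    and \<theta> :: "'a::finite \<Rightarrow> int ^ 'd \<Rightarrow> 'a"
  assumes "nontrivial_subst s \<theta>"
    and "primitive_subst s \<theta>"
    and "bijective_subst s \<theta>"
  shows "Aut_set (subst_shift s \<theta>) \<lhd> Sym_group (subst_shift s \<theta>)
    \<and> (\<exists>K. subgroup K (hyperoctahedral_group :: (('d \<Rightarrow> int) \<times> ('d \<Rightarrow> 'd)) monoid)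
         \<and> Sym_group (subst_shift s \<theta>) Mod Aut_set (subst_shift s \<theta>)
            \<cong> hyperoctahedral_group\<lparr>carrier := K\<rparr>)
    \<and> (\<exists>H. subgroup H (Sym_group (subst_shift s \<theta>))
         \<and> finite (rcosets\<^bsub>Sym_group (subst_shift s \<theta>)\<^esub> H)
         \<and> (Sym_group (subst_shift s \<theta>))\<lparr>carrier := H\<rparr>
            \<cong> product_group (UNIV :: 'd set) (\<lambda>_. integer_group))"
proof -
  interpret prim_bij_subst s \<theta>
    using assms by unfold_locales (auto simp: nontrivial_subst_def bijective_subst_def)
  show ?thesis
    using Aut_normal quotient_hyperoctahedral subgroup_translations
      finite_rcosets_translations translations_iso by blast
qed

end
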